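(* Let $\alpha:S^1\to S^1$ be an orientation preserving homeomorphism, $\gamma:\mathbb R\to\mathbb R$ a lift of $\alpha$ with $\gamma(0)>0$, and let $U$, $\mathcal A\subset L(L^2([0,\infty)))$ and $\mathcal B=C^*\big(\bigcup_{n=0}^\infty U^{*n}\mathcal AU^n\big)$ be the associated compressed objects. Then the spectrum $\widetilde M$ of $\mathcal B$ assumes (up to homeomorphism) one of the forms: i) If $\gamma(0)\ge1$, then $\widetilde M=\overline{\mathbb N}\times S^1$. ii) If $\gamma(0)\in(0,1)$, then $\widetilde M=\bigcup_{N\in\mathbb N}M_N\cup M_\infty\subset\overline{\mathbb N}\times S^1$, where $M_\infty=\{\infty\}\times S^1$ is a circle and the sets $M_N$, $N\in\mathbb N$, are arcs: $$M_N=\{N\}\times[\alpha^N(1),\alpha^{N+1}(1)],$$ where $[\alpha^N(1),\alpha^{N+1}(1)]$ stands for the arc on $S^1$ with origin $\alpha^N(1)$ and ending $\alpha^{N+1}(1)$. Under the identification $\mathcal B=C(\widetilde M)$ the operator $U$ generates on $\widetilde M$ the mapping $\widetilde\alpha$ that acts according to the formula $$\widetilde\alpha(N,x)=(N+1,\alpha(x)),\qquad\widetilde\alpha(\infty,x)=(\infty,\alpha(x)).$$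
   Context: $\mathbb N=\{0,1,2,\dots\}$; $\overline{\mathbb N}=\mathbb N\cup\{\infty\}$ is the one-point compactification of the discrete space $\mathbb N$. $S^1=\{z\in\mathbb C:|z|=1\}$; arcs on $S^1$ are taken in the positive (counterclockwise) orientation: the arc $[\alpha^N(1),\alpha^{N+1}(1)]$ is $\{e^{2\pi it}:t\in[\gamma^N(0),\gamma^{N+1}(0)]\}$. A lift of $\alpha$ is a continuous $\gamma:\mathbb R\to\mathbb R$ with $\alpha(e^{2\pi it})=e^{2\pi i\gamma(t)}$; it is an increasing homeomorphism with $\gamma(t+1)=\gamma(t)+1$. $\mathbb U$ is the unitary operator on $L^2(\mathbb R)$ given by $(\mathbb Uf)(t)=\sqrt{|\gamma'(t)|}\,f(\gamma(t))$, a formula which (by monotonicity of $\gamma$) makes sense for almost all $t\in\mathbb R$; $(\mathbb U^*f)(t)=\sqrt{|(\gamma^{-1})'(t)|}\,f(\gamma^{-1}(t))$. Let $P$ be the orthogonal projection of $L^2(\mathbb R)$ onto $H=L^2([0,\infty))$; $U=P\mathbb UP\in L(H)$, and $\mathcal A\subset L(H)$ is the algebra of operators of multiplication by (restrictions to $[0,\infty)$ of) continuous functions on $\mathbb R$ of period $1$, so $\mathcal A\cong C(S^1)$. The $C^*$-algebra $\mathcal B$ is commutative and $U\mathcal BU^*\subset\mathcal B$, $U^*\mathcal BU\subset\mathcal B$. The map generated by $U$ on the spectrum of $\mathcal B$ is $x\mapsto x(U\,\cdot\,U^* )$. *)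

theory Defs
  imports "HOL-Analysis.Analysis"
begin

section \<open>The Hilbert space of square integrable functions on the line\<close>

definition sq_integrable :: "(real \<Rightarrow> complex) set"
  where "sq_integrable =
    {f \<in> borel_measurable lborel. integrable lborel (\<lambda>t. (cmod (f t))\<^sup>2)}"

lemma sq_integrableD [measurable_dest]: "f \<in> sq_integrable \<Longrightarrow> f \<in> borel_measurable borel"
  by (simp add: sq_integrable_def)

lemma sq_integrable_bound:
  assumes "f \<in> sq_integrable" "g \<in> sq_integrable" "h \<in> borel_measurable borel"
    and "AE t in lborel. cmod (h t) \<le> c * (cmod (f t) + cmod (g t))"
  shows "h \<in> sq_integrable"
proof -
  have [measurable]: "f \<in> borel_measurable borel" "g \<in> borel_measurable borel"
    "h \<in> borel_measurable borel"
    using assms by (auto simp: sq_integrable_def)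
  have "integrable lborel (\<lambda>t. (cmod (h t))\<^sup>2)"
  proof (rule Bochner_Integration.integrable_bound)
    show "integrable lborel (\<lambda>t. 2 * c\<^sup>2 * ((cmod (f t))\<^sup>2 + (cmod (g t))\<^sup>2))"
      using assms by (auto simp: sq_integrable_def)
    show "AE t in lborel. norm ((cmod (h t))\<^sup>2) \<le> norm (2 * c\<^sup>2 * ((cmod (f t))\<^sup>2 + (cmod (g t))\<^sup>2))"
      using assms(4)
    proof eventually_elim
      fix t assume "cmod (h t) \<le> c * (cmod (f t) + cmod (g t))"
      then have "(cmod (h t))\<^sup>2 \<le> (c * (cmod (f t) + cmod (g t)))\<^sup>2"
        by (intro power_mono) auto
      also have "\<dots> = c\<^sup>2 * (cmod (f t) + cmod (g t))\<^sup>2"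
        by (simp add: power_mult_distrib)
      also have "\<dots> \<le> c\<^sup>2 * (2 * ((cmod (f t))\<^sup>2 + (cmod (g t))\<^sup>2))"
        using sum_squares_bound[of "cmod (f t)" "cmod (g t)"]
        by (intro mult_left_mono) (auto simp: power2_sum)
      finally show "norm ((cmod (h t))\<^sup>2) \<le> norm (2 * c\<^sup>2 * ((cmod (f t))\<^sup>2 + (cmod (g t))\<^sup>2))"
        by (simp add: algebra_simps)
    qed
  qed measurable
  then show ?thesis by (simp add: sq_integrable_def)
qed

lemma sq_integrable_zero: "(\<lambda>_. 0) \<in> sq_integrable"
  by (simp add: sq_integrable_def)

lemma sq_integrable_add:
  assumes "f \<in> sq_integrable" "g \<in> sq_integrable"
  shows "(\<lambda>t. f t + g t) \<in> sq_integrable"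
  using assms by (intro sq_integrable_bound[OF assms, where c = 1])
    (auto simp: sq_integrable_def norm_triangle_ineq)

lemma sq_integrable_mult:
  assumes f: "f \<in> sq_integrable" and [measurable]: "\<phi> \<in> borel_measurable borel"
    and "\<And>t. cmod (\<phi> t) \<le> c"
  shows "(\<lambda>t. \<phi> t * f t) \<in> sq_integrable"
proof (rule sq_integrable_bound[OF f f, where c = c])
  have [measurable]: "f \<in> borel_measurable borel" using f by (simp add: sq_integrable_def)
  show "(\<lambda>t. \<phi> t * f t) \<in> borel_measurable borel" by measurable
  have "cmod (\<phi> t * f t) \<le> c * (cmod (f t) + cmod (f t))" for t
  proof -
    have "0 \<le> c" using assms(3)[of t] norm_ge_zero order_trans by blast
    then have "cmod (\<phi> t) * cmod (f t) \<le> c * (cmod (f t) + cmod (f t))"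
      using assms(3)[of t] by (intro mult_mono) auto
    then show ?thesis by (simp add: norm_mult)
  qed
  then show "AE t in lborel. cmod (\<phi> t * f t) \<le> c * (cmod (f t) + cmod (f t))" by simp
qed

lemma sq_integrable_cmult: "f \<in> sq_integrable \<Longrightarrow> (\<lambda>t. c * f t) \<in> sq_integrable"
  by (rule sq_integrable_mult[where c = "cmod c"]) auto

lemma cnj_product_measurable:
  assumes "f \<in> sq_integrable" "g \<in> sq_integrable"
  shows "(\<lambda>t. f t * cnj (g t)) \<in> borel_measurable borel"
proof -
  have [measurable]: "f \<in> borel_measurable borel" "g \<in> borel_measurable borel"
    using assms by (auto simp: sq_integrable_def)
  have "cnj \<in> borel_measurable borel"
    by (intro borel_measurable_continuous_onI continuous_on_cnj continuous_on_id)
  then have "(\<lambda>t. cnj (g t)) \<in> borel_measurable borel"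
    by (rule measurable_compose[rotated]) simp
  then show ?thesis by simp
qed

lemma sq_integrable_inner:
  assumes "f \<in> sq_integrable" "g \<in> sq_integrable"
  shows "integrable lborel (\<lambda>t. f t * cnj (g t))"
proof (rule Bochner_Integration.integrable_bound)
  have [measurable]: "f \<in> borel_measurable borel" "g \<in> borel_measurable borel"
    using assms by (auto simp: sq_integrable_def)
  show "integrable lborel (\<lambda>t. (cmod (f t))\<^sup>2 + (cmod (g t))\<^sup>2)"
    using assms by (auto simp: sq_integrable_def)
  show "(\<lambda>t. f t * cnj (g t)) \<in> borel_measurable lborel"
    using cnj_product_measurable[OF assms] by simp
  have "cmod (f t * cnj (g t)) \<le> (cmod (f t))\<^sup>2 + (cmod (g t))\<^sup>2" for t
  proof -
    have "0 \<le> cmod (f t) * cmod (g t)" by simp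
    then show ?thesis
      using sum_squares_bound[of "cmod (f t)" "cmod (g t)"] unfolding norm_mult complex_mod_cnj
      by linarith
  qed
  then show "AE t in lborel. norm (f t * cnj (g t)) \<le> norm ((cmod (f t))\<^sup>2 + (cmod (g t))\<^sup>2)"
    by simp
qed

definition L2_rel :: "(real \<Rightarrow> complex) \<Rightarrow> (real \<Rightarrow> complex) \<Rightarrow> bool"
  where "L2_rel f g \<longleftrightarrow>
    f \<in> sq_integrable \<and> g \<in> sq_integrable \<and> (AE t in lborel. f t = g t)"

quotient_type L2 = "real \<Rightarrow> complex" / partial: L2_rel
  morphisms L2_rep L2_class
proof (rule part_equivpI)
  show "\<exists>f. L2_rel f f"
    by (rule exI[of _ "\<lambda>_. 0"]) (simp add: L2_rel_def sq_integrable_zero)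
  show "symp L2_rel" by (auto intro!: sympI simp: L2_rel_def)
  show "transp L2_rel" unfolding L2_rel_def by (rule transpI) auto
qed


lemma L2_rep_in [simp]: "L2_rep F \<in> sq_integrable"
  using Quotient_rep_reflp[OF Quotient_L2, of F] by (simp add: L2_rel_def)

lemma L2_rep_measurable [measurable]: "L2_rep F \<in> borel_measurable borel"
  by (rule sq_integrableD) simp

lemma L2_class_rep [simp]: "L2_class (L2_rep F) = F"
  by (rule Quotient_abs_rep[OF Quotient_L2])

lemma L2_rep_class: "f \<in> sq_integrable \<Longrightarrow> AE t in lborel. L2_rep (L2_class f) t = f t"
  using Quotient_rep_abs[OF Quotient_L2, of f] by (simp add: L2_rel_def)

lemma L2_class_eqI:
  "f \<in> sq_integrable \<Longrightarrow> g \<in> sq_integrable \<Longrightarrow> AE t in lborel. f t = g t \<Longrightarrow>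
    L2_class f = L2_class g"
  using Quotient_rel_abs[OF Quotient_L2, of f g] by (simp add: L2_rel_def)

lemma L2_eqI: "AE t in lborel. L2_rep F t = L2_rep G t \<Longrightarrow> F = G"
  using L2_class_eqI[of "L2_rep F" "L2_rep G"] by simp

lift_definition scaleC :: "complex \<Rightarrow> L2 \<Rightarrow> L2" is "\<lambda>c f t. c * f t"
  by (auto simp: L2_rel_def sq_integrable_cmult)

lift_definition cinner :: "L2 \<Rightarrow> L2 \<Rightarrow> complex" is "\<lambda>f g. LINT t|lborel. f t * cnj (g t)"
proof -
  fix f f' g g' assume *: "L2_rel f f'" "L2_rel g g'"
  show "(LINT t|lborel. f t * cnj (g t)) = (LINT t|lborel. f' t * cnj (g' t))"
  proof (rule integral_cong_AE)
    show "AE t in lborel. f t * cnj (g t) = f' t * cnj (g' t)"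
      using * by (auto simp: L2_rel_def)
  qed (use * in \<open>auto simp: L2_rel_def cnj_product_measurable\<close>)
qed

instantiation L2 :: ab_group_add
begin

lift_definition zero_L2 :: L2 is "\<lambda>_. 0"
  by (simp add: L2_rel_def sq_integrable_zero)

lift_definition plus_L2 :: "L2 \<Rightarrow> L2 \<Rightarrow> L2" is "\<lambda>f g t. f t + g t"
  by (auto simp: L2_rel_def sq_integrable_add)

lift_definition uminus_L2 :: "L2 \<Rightarrow> L2" is "\<lambda>f t. - f t"
  using sq_integrable_cmult[of _ "-1"] by (auto simp: L2_rel_def)

definition minus_L2 :: "L2 \<Rightarrow> L2 \<Rightarrow> L2"
  where "minus_L2 F G = F + - G"

instance
proof
  fix a b c :: L2
  show "a + b + c = a + (b + c)"
    by transfer (auto simp: L2_rel_def add.assoc intro!: sq_integrable_add)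
  show "a + b = b + a"
    by transfer (auto simp: L2_rel_def add.commute intro!: sq_integrable_add)
  show "0 + a = a"
    by transfer (auto simp: L2_rel_def)
  show "- a + a = 0"
    by transfer (auto simp: L2_rel_def sq_integrable_zero)
qed (rule minus_L2_def)

end

lemma scaleC_simps:
  "scaleC c (F + G) = scaleC c F + scaleC c G"
  "scaleC (c + d) F = scaleC c F + scaleC d F"
  "scaleC c (scaleC d F) = scaleC (c * d) F"
  "scaleC 1 F = F"
     apply (transfer, auto simp: L2_rel_def algebra_simps intro!: sq_integrable_add sq_integrable_cmult)
    apply (transfer, auto simp: L2_rel_def algebra_simps intro!: sq_integrable_add sq_integrable_cmult)
   apply (transfer, auto simp: L2_rel_def algebra_simps intro!: sq_integrable_cmult)
  apply (transfer, auto simp: L2_rel_def)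
  done

lemma cinner_add_left: "cinner (F + G) K = cinner F K + cinner G K"
proof transfer
  fix f g k assume "L2_rel f f" "L2_rel g g" "L2_rel k k"
  then show "(LINT t|lborel. (f t + g t) * cnj (k t)) =
      (LINT t|lborel. f t * cnj (k t)) + (LINT t|lborel. g t * cnj (k t))"
    by (simp add: L2_rel_def distrib_right sq_integrable_inner)
qed

lemma cinner_scaleC_left: "cinner (scaleC c F) K = c * cinner F K"
  by transfer (simp add: mult.assoc)

lemma cinner_commute: "cinner F G = cnj (cinner G F)"
proof transfer
  fix f g assume "L2_rel f f" "L2_rel g g"
  show "(LINT t|lborel. f t * cnj (g t)) = cnj (LINT t|lborel. g t * cnj (f t))"
    using Bochner_Integration.integral_cnj[of lborel "\<lambda>t. g t * cnj (f t)"] by (simp add: mult.commute)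
qed

lemma cinner_self: "cinner F F = of_real (LINT t|lborel. (cmod (L2_rep F t))\<^sup>2)"
proof -
  have "cinner F F = (LINT t|lborel. L2_rep F t * cnj (L2_rep F t))"
    by (simp add: cinner_def)
  also have "\<dots> = (LINT t|lborel. complex_of_real ((cmod (L2_rep F t))\<^sup>2))"
    by (simp only: complex_norm_square)
  finally show ?thesis by (simp only: integral_complex_of_real)
qed

lemma cinner_self_eq_0: "cinner F F = 0 \<longleftrightarrow> F = 0"
proof
  assume "cinner F F = 0"
  then have "(LINT t|lborel. (cmod (L2_rep F t))\<^sup>2) = 0"
    by (simp add: cinner_self)
  moreover have "integrable lborel (\<lambda>t. (cmod (L2_rep F t))\<^sup>2)"
    using L2_rep_in[of F] unfolding sq_integrable_def by blast
  ultimately have "AE t in lborel. (cmod (L2_rep F t))\<^sup>2 = 0"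
    by (subst (asm) integral_nonneg_eq_0_iff_AE) auto
  then have "AE t in lborel. L2_rep F t = (\<lambda>_. 0) t"
    by simp
  then have "L2_class (L2_rep F) = L2_class (\<lambda>_. 0)"
    by (intro L2_class_eqI) (auto simp: sq_integrable_zero)
  then show "F = 0" by (simp add: zero_L2_def)
next
  assume "F = 0"
  then show "cinner F F = 0"
    using cinner_scaleC_left[of 0 F F] cinner_add_left[of 0 0 F] by simp
qed

instantiation L2 :: real_vector
begin

definition scaleR_L2 :: "real \<Rightarrow> L2 \<Rightarrow> L2"
  where "scaleR_L2 r F = scaleC (of_real r) F"

instance
  by standard (simp_all add: scaleR_L2_def scaleC_simps)

end

instantiation L2 :: real_inner
begin

definition inner_L2 :: "L2 \<Rightarrow> L2 \<Rightarrow> real"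
  where "inner_L2 F G = Re (cinner F G)"

definition norm_L2 :: "L2 \<Rightarrow> real"
  where "norm_L2 F = sqrt (inner F F)"

definition sgn_L2 :: "L2 \<Rightarrow> L2"
  where "sgn_L2 F = F /\<^sub>R norm F"

definition dist_L2 :: "L2 \<Rightarrow> L2 \<Rightarrow> real"
  where "dist_L2 F G = norm (F - G)"

definition uniformity_L2 :: "(L2 \<times> L2) filter"
  where "uniformity_L2 = (INF e\<in>{0 <..}. principal {(F, G). dist F G < e})"

definition open_L2 :: "L2 set \<Rightarrow> bool"
  where "open_L2 S \<longleftrightarrow> (\<forall>F\<in>S. \<forall>\<^sub>F (F', G) in uniformity. F' = F \<longrightarrow> G \<in> S)"

instance
proof
  fix a :: real and x y z :: L2
  show "inner x y = inner y x"
    unfolding inner_L2_def by (subst cinner_commute) simp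
  show "inner (x + y) z = inner x z + inner y z"
    by (simp add: inner_L2_def cinner_add_left)
  show "inner (a *\<^sub>R x) y = a * inner x y"
    by (simp add: inner_L2_def scaleR_L2_def cinner_scaleC_left)
  show "0 \<le> inner x x"
    by (simp add: inner_L2_def cinner_self)
  show "inner x x = 0 \<longleftrightarrow> x = 0"
    by (subst cinner_self_eq_0[symmetric]) (simp add: inner_L2_def cinner_self)
qed (rule norm_L2_def sgn_L2_def dist_L2_def uniformity_L2_def open_L2_def)+

end

lemma norm_L2_eq: "norm F = sqrt (LINT t|lborel. (cmod (L2_rep F t))\<^sup>2)"
  by (simp add: norm_L2_def inner_L2_def cinner_self)

section \<open>Operators and C*-algebras of operators\<close>

definition complex_linear :: "(L2 \<Rightarrow>\<^sub>L L2) \<Rightarrow> bool"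
  where "complex_linear T \<longleftrightarrow> (\<forall>c F. T (scaleC c F) = scaleC c (T F))"

definition is_unitary :: "(L2 \<Rightarrow>\<^sub>L L2) \<Rightarrow> bool"
  where "is_unitary T \<longleftrightarrow>
    complex_linear T \<and> surj (blinfun_apply T) \<and> (\<forall>F G. cinner (T F) (T G) = cinner F G)"

text \<open>
  By the Riesz theorem the operator below exists for every bounded complex-linear operator;
  it is unique by the lemma that follows.
\<close>

definition adj :: "(L2 \<Rightarrow>\<^sub>L L2) \<Rightarrow> (L2 \<Rightarrow>\<^sub>L L2)"
  where "adj T = (THE S :: L2 \<Rightarrow>\<^sub>L L2. \<forall>F G. cinner (T F) G = cinner F (S G))"

lemma cinner_ext: "(\<And>K. cinner F K = cinner G K) \<Longrightarrow> F = G"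
proof -
  assume *: "\<And>K. cinner F K = cinner G K"
  have "inner (F - G) (F - G) = 0"
    by (simp add: inner_diff_left) (simp add: inner_L2_def *)
  then show ?thesis by simp
qed

lemma adj_eqI:
  fixes S T :: "L2 \<Rightarrow>\<^sub>L L2"
  assumes "\<And>F G. cinner (T F) G = cinner F (S G)"
  shows "adj T = S"
  unfolding adj_def
proof (rule the_equality)
  fix S' :: "L2 \<Rightarrow>\<^sub>L L2" assume "\<forall>F G. cinner (T F) G = cinner F (S' G)"
  then have "cinner F (S' G) = cinner F (S G)" for F G using assms by metis
  then show "S' = S"
    by (intro blinfun_eqI cinner_ext) (metis cinner_commute)
qed (use assms in blast)

definition mult_op :: "(real \<Rightarrow> complex) \<Rightarrow> (L2 \<Rightarrow>\<^sub>L L2)"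
  where "mult_op \<phi> = Blinfun (\<lambda>F. L2_class (\<lambda>t. \<phi> t * L2_rep F t))"

lemma L2_rep_add: "AE t in lborel. L2_rep (F + G) t = L2_rep F t + L2_rep G t"
proof -
  have "F + G = L2_class (\<lambda>t. L2_rep F t + L2_rep G t)" by (simp add: plus_L2_def)
  then show ?thesis
    using L2_rep_class[of "\<lambda>t. L2_rep F t + L2_rep G t"] by (simp add: sq_integrable_add)
qed

lemma L2_rep_scaleC: "AE t in lborel. L2_rep (scaleC c F) t = c * L2_rep F t"
proof -
  have "scaleC c F = L2_class (\<lambda>t. c * L2_rep F t)" by (simp add: scaleC_def)
  then show ?thesis
    using L2_rep_class[of "\<lambda>t. c * L2_rep F t"] by (simp add: sq_integrable_cmult)
qed

lemma mult_op_bounded_linear: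
  assumes [measurable]: "\<phi> \<in> borel_measurable borel" and b: "\<And>t. cmod (\<phi> t) \<le> c"
  shows "bounded_linear (\<lambda>F. L2_class (\<lambda>t. \<phi> t * L2_rep F t))"
proof (rule bounded_linear_intro[where K = c])
  note m = sq_integrable_mult[OF L2_rep_in assms]
  fix F G :: L2 and r :: real
  let ?M = "\<lambda>F. L2_class (\<lambda>t. \<phi> t * L2_rep F t)"
  show "?M (F + G) = ?M F + ?M G"
  proof (rule L2_eqI)
    show "AE t in lborel. L2_rep (?M (F + G)) t = L2_rep (?M F + ?M G) t"
      using L2_rep_class[OF m[of F]] L2_rep_class[OF m[of G]] L2_rep_class[OF m[of "F + G"]]
        L2_rep_add[of F G] L2_rep_add[of "?M F" "?M G"]
      by eventually_elim (simp add: algebra_simps)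
  qed
  show "?M (r *\<^sub>R F) = r *\<^sub>R ?M F"
    unfolding scaleR_L2_def
  proof (rule L2_eqI)
    show "AE t in lborel. L2_rep (?M (scaleC r F)) t = L2_rep (scaleC r (?M F)) t"
      using L2_rep_class[OF m[of F]] L2_rep_class[OF m[of "scaleC r F"]]
        L2_rep_scaleC[of r F] L2_rep_scaleC[of r "?M F"]
      by eventually_elim (simp add: algebra_simps)
  qed
  have c: "0 \<le> c" using b[of 0] norm_ge_zero order_trans by blast
  have int: "integrable lborel (\<lambda>t. (cmod (L2_rep F t))\<^sup>2)" for F
    using L2_rep_in[of F] unfolding sq_integrable_def by blast
  have "(LINT t|lborel. (cmod (L2_rep (?M F) t))\<^sup>2) \<le> (LINT t|lborel. c\<^sup>2 * (cmod (L2_rep F t))\<^sup>2)"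
  proof (rule integral_mono_AE)
    show "AE t in lborel. (cmod (L2_rep (?M F) t))\<^sup>2 \<le> c\<^sup>2 * (cmod (L2_rep F t))\<^sup>2"
      using L2_rep_class[OF m[of F]]
    proof eventually_elim
      fix t assume "L2_rep (?M F) t = \<phi> t * L2_rep F t"
      then show "(cmod (L2_rep (?M F) t))\<^sup>2 \<le> c\<^sup>2 * (cmod (L2_rep F t))\<^sup>2"
        by (simp add: norm_mult power_mult_distrib mult_right_mono power_mono b)
    qed
  qed (use int in auto)
  then have "norm (?M F) \<le> sqrt (c\<^sup>2 * (LINT t|lborel. (cmod (L2_rep F t))\<^sup>2))"
    by (simp add: norm_L2_eq)
  then show "norm (?M F) \<le> norm F * c"
    using c by (simp add: norm_L2_eq real_sqrt_mult mult.commute)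
qed

lemma mult_op_rep:
  assumes "\<phi> \<in> borel_measurable borel" "\<And>t. cmod (\<phi> t) \<le> c"
  shows "AE t in lborel. L2_rep (mult_op \<phi> F) t = \<phi> t * L2_rep F t"
  unfolding mult_op_def bounded_linear_Blinfun_apply[OF mult_op_bounded_linear[OF assms]]
  by (intro L2_rep_class sq_integrable_mult[OF _ assms]) simp

definition scale_op :: "complex \<Rightarrow> (L2 \<Rightarrow>\<^sub>L L2) \<Rightarrow> (L2 \<Rightarrow>\<^sub>L L2)"
  where "scale_op c T = mult_op (\<lambda>_. c) o\<^sub>L T"

definition op_power :: "(L2 \<Rightarrow>\<^sub>L L2) \<Rightarrow> nat \<Rightarrow> (L2 \<Rightarrow>\<^sub>L L2)"
  where "op_power T n = ((o\<^sub>L) T ^^ n) id_blinfun"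

definition cstar_algebra :: "(L2 \<Rightarrow>\<^sub>L L2) set \<Rightarrow> bool"
  where "cstar_algebra C \<longleftrightarrow>
    C \<subseteq> Collect complex_linear \<and> 0 \<in> C \<and>
    (\<forall>S\<in>C. \<forall>T\<in>C. S + T \<in> C \<and> S o\<^sub>L T \<in> C) \<and>
    (\<forall>c. \<forall>T\<in>C. scale_op c T \<in> C) \<and>
    (\<forall>T\<in>C. adj T \<in> C) \<and> closed C"

definition cstar_generated :: "(L2 \<Rightarrow>\<^sub>L L2) set \<Rightarrow> (L2 \<Rightarrow>\<^sub>L L2) set"
  where "cstar_generated S = \<Inter> {C. cstar_algebra C \<and> S \<subseteq> C}"

text \<open>
  Characters are taken to be undefined outside the algebra, so that they are points of the
  product space of scalars indexed by the algebra; the topology of pointwise convergence on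
  the algebra is the weak-* topology of the spectrum.
\<close>

definition characters :: "(L2 \<Rightarrow>\<^sub>L L2) set \<Rightarrow> ((L2 \<Rightarrow>\<^sub>L L2) \<Rightarrow> complex) set"
  where "characters C = {x \<in> extensional C.
    (\<exists>T\<in>C. x T \<noteq> 0) \<and>
    (\<forall>S\<in>C. \<forall>T\<in>C. x (S + T) = x S + x T \<and> x (S o\<^sub>L T) = x S * x T) \<and>
    (\<forall>c. \<forall>T\<in>C. x (scale_op c T) = c * x T)}"

definition spectrum :: "(L2 \<Rightarrow>\<^sub>L L2) set \<Rightarrow> ((L2 \<Rightarrow>\<^sub>L L2) \<Rightarrow> complex) topology"
  where "spectrum C = subtopology (product_topology (\<lambda>_. euclidean) C) (characters C)"

definition generated_map ::
    "(L2 \<Rightarrow>\<^sub>L L2) \<Rightarrow> (L2 \<Rightarrow>\<^sub>L L2) set \<Rightarrow> ((L2 \<Rightarrow>\<^sub>L L2) \<Rightarrow> complex) \<Rightarrow> ((L2 \<Rightarrow>\<^sub>L L2) \<Rightarrow> complex)"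
  where "generated_map U C x = (\<lambda>T\<in>C. x (U o\<^sub>L T o\<^sub>L adj U))"

section \<open>Compression to the half-line\<close>

text \<open>
  The space \<open>H\<close> of square integrable functions on \<open>[0,\<infinity>)\<close> is the closed subspace
  of functions vanishing almost everywhere on the negative half-line. Operators on \<open>H\<close> are
  identified with the operators \<open>T\<close> on the whole space such that \<open>T = P T P\<close>; sums,
  products, adjoints and norms are the same in both readings, and \<open>P\<close> is the identity of \<open>H\<close>.
\<close>

definition half_line_space :: "L2 set"
  where "half_line_space = {F. AE t in lborel. t < 0 \<longrightarrow> L2_rep F t = 0}"

definition orth_proj :: "L2 set \<Rightarrow> (L2 \<Rightarrow>\<^sub>L L2)"
  where "orth_proj S = Blinfun (\<lambda>F. THE G. G \<in> S \<and> (\<forall>K\<in>S. cinner (F - G) K = 0))"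

definition proj_H :: "L2 \<Rightarrow>\<^sub>L L2"
  where "proj_H = orth_proj half_line_space"

definition compression :: "(L2 \<Rightarrow>\<^sub>L L2) \<Rightarrow> (L2 \<Rightarrow>\<^sub>L L2)"
  where "compression T = proj_H o\<^sub>L T o\<^sub>L proj_H"

definition alg_A :: "(L2 \<Rightarrow>\<^sub>L L2) set"
  where "alg_A = {compression (mult_op a) | a :: real \<Rightarrow> complex.
    continuous_on UNIV a \<and> (\<forall>t. a (t + 1) = a t)}"

definition alg_B :: "(L2 \<Rightarrow>\<^sub>L L2) \<Rightarrow> (L2 \<Rightarrow>\<^sub>L L2) set"
  where "alg_B U = cstar_generated
    (\<Union>n. {op_power (adj U) n o\<^sub>L T o\<^sub>L op_power U n | T. T \<in> alg_A})"

lemma proj_H_eq: "proj_H = mult_op (indicator {0..})"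
proof -
  let ?i = "indicator {0..} :: real \<Rightarrow> complex"
  have i: "?i \<in> borel_measurable borel" "\<And>t. cmod (?i t) \<le> 1"
    by (auto simp: indicator_def)
  note rep = mult_op_rep[OF i]
  have "(THE G. G \<in> half_line_space \<and> (\<forall>K\<in>half_line_space. cinner (F - G) K = 0)) =
      mult_op ?i F" (is "(THE G. ?Q G) = ?G") for F
  proof (rule the_equality)
    have G: "?G \<in> half_line_space"
      using rep[of F] unfolding half_line_space_def mem_Collect_eq by eventually_elim simp
    moreover have "cinner (F - ?G) K = 0" if "K \<in> half_line_space" for K
    proof -
      have "AE t in lborel. L2_rep (F - ?G) t * cnj (L2_rep K t) = 0"
        using that[unfolded half_line_space_def, simplified] rep[of F]
          L2_rep_add[of "F - ?G" ?G]
      proof eventually_elim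
        fix t
        assume "t < 0 \<longrightarrow> L2_rep K t = 0" "L2_rep ?G t = ?i t * L2_rep F t"
          "L2_rep (F - ?G + ?G) t = L2_rep (F - ?G) t + L2_rep ?G t"
        then show "L2_rep (F - ?G) t * cnj (L2_rep K t) = 0"
          by (cases "t < 0") auto
      qed
      then have "(LINT t|lborel. L2_rep (F - ?G) t * cnj (L2_rep K t)) = 0"
        by (subst integral_cong_AE[where g = "\<lambda>_. 0"])
          (auto intro: cnj_product_measurable)
      then show ?thesis by (simp add: cinner_def)
    qed
    ultimately show "?Q ?G" by blast
    fix G' assume G': "?Q G'"
    have "G' - ?G \<in> half_line_space"
      using G G' L2_rep_add[of "G' - ?G" ?G] unfolding half_line_space_def by auto
    then have "cinner (F - G') (G' - ?G) = 0" "cinner (F - ?G) (G' - ?G) = 0"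
      using G' \<open>?Q ?G\<close> by blast+
    then have "inner (G' - ?G) (G' - ?G) = 0"
      using inner_diff_left[of "F - ?G" "F - G'" "G' - ?G"] by (simp add: inner_L2_def)
    then show "G' = ?G" by simp
  qed
  then show ?thesis by (simp add: proj_H_def orth_proj_def blinfun_apply_inverse)
qed

section \<open>Circle maps and the model of the spectrum\<close>

definition is_lift :: "(complex \<Rightarrow> complex) \<Rightarrow> (real \<Rightarrow> real) \<Rightarrow> bool"
  where "is_lift \<alpha> \<gamma> \<longleftrightarrow>
    continuous_on UNIV \<gamma> \<and> (\<forall>t. \<alpha> (cis (2 * pi * t)) = cis (2 * pi * \<gamma> t))"

definition orientation_preserving :: "(complex \<Rightarrow> complex) \<Rightarrow> bool"
  where "orientation_preserving \<alpha> \<longleftrightarrow> (\<exists>\<gamma>. is_lift \<alpha> \<gamma> \<and> strict_mono \<gamma>)"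

text \<open>
  \<open>unit_arc \<gamma> N\<close> is the positively oriented arc from \<open>\<alpha>^N(1)\<close> to \<open>\<alpha>^(N+1)(1)\<close>
  for a map \<open>\<alpha>\<close> with lift \<open>\<gamma>\<close>.
\<close>

definition unit_arc :: "(real \<Rightarrow> real) \<Rightarrow> nat \<Rightarrow> complex set"
  where "unit_arc \<gamma> N = (\<lambda>t. cis (2 * pi * t)) ` {(\<gamma> ^^ N) 0 .. (\<gamma> ^^ Suc N) 0}"

text \<open>
  The one-point compactification of the discrete natural numbers is the type \<^typ>\<open>enat\<close>
  with its order topology.
\<close>

lemma open_enat_iff_cofinite: "open (S :: enat set) \<longleftrightarrow> (\<infinity> \<in> S \<longrightarrow> finite (- S))"
proof -
  have "(\<exists>n::nat. {enat n <..} \<subseteq> S) \<longleftrightarrow> finite (- S)" if "\<infinity> \<in> S"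
  proof
    assume "\<exists>n::nat. {enat n <..} \<subseteq> S"
    then obtain n where "{enat n <..} \<subseteq> S" by blast
    then have "- S \<subseteq> {..enat n}" by (auto simp: not_less[symmetric])
    then show "finite (- S)" by (rule finite_subset) (rule finite_enat_bounded[where n = n], auto)
  next
    assume fin: "finite (- S)"
    have "x \<le> enat (Max (the_enat ` (- S)))" if x: "x \<in> - S" for x
    proof (cases x)
      case (enat k)
      then have "k \<in> the_enat ` (- S)" using x by force
      then show ?thesis using fin enat by simp
    qed (use x \<open>\<infinity> \<in> S\<close> in auto)
    then show "\<exists>n::nat. {enat n <..} \<subseteq> S" by (meson ComplI greaterThan_iff not_less subsetI)
  qed
  then show ?thesis by (auto simp: open_enat_iff)
qed

definition model_map :: "(complex \<Rightarrow> complex) \<Rightarrow> enat \<times> complex \<Rightarrow> enat \<times> complex"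
  where "model_map \<alpha> = (\<lambda>(n, z). case n of enat N \<Rightarrow> (enat (N + 1), \<alpha> z) | \<infinity> \<Rightarrow> (\<infinity>, \<alpha> z))"

end

theory Submission
  imports Defs
begin

text \<open>
  Since \<open>\<gamma>\<close> maps the half-line into itself, \<open>U = P UU\<close>, and conjugation by \<open>U\<close> and \<open>U*\<close> turns
  multiplication operators into multiplication operators. The generators of \<open>B\<close> become the functions
  equal to \<open>a \<circ> \<gamma>^-n\<close> on \<open>[\<gamma>^n(0), \<infinity>)\<close> and to \<open>0\<close> elsewhere. Send \<open>t \<ge> 0\<close> to the pair of its level
  \<open>N\<close>, determined by \<open>\<gamma>^N(0) \<le> t < \<gamma>^(N+1)(0)\<close>, and of its class on the circle; the level is \<open>\<infinity>\<close>
  beyond a fixed point of \<open>\<gamma>\<close>. The generators factor through this projection, whose image is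
  essentially dense in the model \<open>M\<close>, so composition with it embeds \<open>C(M)\<close> isometrically into the
  operators, and Stone-Weierstrass identifies the image with \<open>B\<close>. The characters of \<open>C(M)\<close>
  are the point evaluations, and \<open>t \<mapsto> \<gamma> t\<close> raises the level by one and applies \<open>\<alpha>\<close> on the circle.
\<close>

section \<open>Multiplication operators\<close>

text \<open>\<open>mult_op\<close> is built with \<open>Blinfun\<close>, which describes the
  intended map only when that map is bounded and linear. Bounded Borel symbols guarantee this, and
  all symbols below are of this kind.\<close>

definition bounded_borel :: "(real \<Rightarrow> complex) \<Rightarrow> bool"
  where "bounded_borel f \<longleftrightarrow> f \<in> borel_measurable borel \<and> bounded (range f)"

lemma bounded_borelI:
  assumes "f \<in> borel_measurable borel" "\<And>t. cmod (f t) \<le> K"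
  shows "bounded_borel f"
  using assms by (auto simp: bounded_borel_def bounded_iff)

lemma bounded_borelE:
  assumes "bounded_borel f"
  obtains K where "f \<in> borel_measurable borel" "\<And>t. cmod (f t) \<le> K"
  using assms by (auto simp: bounded_borel_def bounded_iff)

lemma bounded_borel_const [simp]: "bounded_borel (\<lambda>_. c)"
  by (rule bounded_borelI) auto

lemma bounded_borel_add:
  assumes "bounded_borel f" "bounded_borel g"
  shows "bounded_borel (\<lambda>t. f t + g t)"
proof -
  obtain K L where "f \<in> borel_measurable borel" "\<And>t. cmod (f t) \<le> K"
    "g \<in> borel_measurable borel" "\<And>t. cmod (g t) \<le> L"
    using assms by (meson bounded_borelE)
  then show ?thesis
    by (intro bounded_borelI[where K = "K + L"]) (auto intro: norm_triangle_mono)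
qed

lemma bounded_borel_mult:
  assumes "bounded_borel f" "bounded_borel g"
  shows "bounded_borel (\<lambda>t. f t * g t)"
proof -
  obtain K L where *: "f \<in> borel_measurable borel" "\<And>t. cmod (f t) \<le> K"
    "g \<in> borel_measurable borel" "\<And>t. cmod (g t) \<le> L"
    using assms by (meson bounded_borelE)
  have "0 \<le> K" using *(2)[of 0] norm_ge_zero order_trans by blast
  with * show ?thesis
    by (intro bounded_borelI[where K = "K * L"]) (auto simp: norm_mult intro!: mult_mono)
qed

lemma bounded_borel_cnj: "bounded_borel f \<Longrightarrow> bounded_borel (\<lambda>t. cnj (f t))"
  using measurable_compose[of f borel borel cnj borel]
    borel_measurable_continuous_onI[of cnj]
  by (auto simp: bounded_borel_def bounded_iff continuous_on_cnj)

lemma bounded_borel_comp: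
  assumes "bounded_borel f" "g \<in> borel_measurable borel"
  shows "bounded_borel (\<lambda>t. f (g t))"
  using assms measurable_compose[of g borel borel f borel]
  by (auto simp: bounded_borel_def bounded_iff)

lemma bounded_borel_indicator: "S \<in> sets borel \<Longrightarrow> bounded_borel (indicator S)"
  by (rule bounded_borelI[where K = 1]) (auto simp: indicator_def)

section \<open>Algebraic rules for multiplication operators\<close>

lemma mult_op_rep': "bounded_borel f \<Longrightarrow> AE t in lborel. L2_rep (mult_op f F) t = f t * L2_rep F t"
  by (erule bounded_borelE) (rule mult_op_rep)

lemma bounded_borel_sq: "bounded_borel f \<Longrightarrow> g \<in> sq_integrable \<Longrightarrow> (\<lambda>t. f t * g t) \<in> sq_integrable"
  by (erule bounded_borelE) (rule sq_integrable_mult)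

lemma mult_op_class:
  assumes "bounded_borel f"
  shows "mult_op f F = L2_class (\<lambda>t. f t * L2_rep F t)"
proof -
  have "AE t in lborel. L2_rep (mult_op f F) t = f t * L2_rep F t"
    by (rule mult_op_rep'[OF assms])
  then have "L2_class (L2_rep (mult_op f F)) = L2_class (\<lambda>t. f t * L2_rep F t)"
    by (intro L2_class_eqI bounded_borel_sq assms) auto
  then show ?thesis by simp
qed

lemma mult_op_comp:
  assumes f: "bounded_borel f" and g: "bounded_borel g"
  shows "mult_op f o\<^sub>L mult_op g = mult_op (\<lambda>t. f t * g t)"
proof (rule blinfun_eqI, rule L2_eqI)
  fix F
  show "AE t in lborel. L2_rep ((mult_op f o\<^sub>L mult_op g) F) t = L2_rep (mult_op (\<lambda>t. f t * g t) F) t"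
    using mult_op_rep'[OF f, of "mult_op g F"] mult_op_rep'[OF g, of F]
      mult_op_rep'[OF bounded_borel_mult[OF f g], of F]
    by eventually_elim simp
qed

lemma mult_op_add:
  assumes f: "bounded_borel f" and g: "bounded_borel g"
  shows "mult_op f + mult_op g = mult_op (\<lambda>t. f t + g t)"
proof (rule blinfun_eqI, rule L2_eqI)
  fix F
  show "AE t in lborel. L2_rep ((mult_op f + mult_op g) F) t = L2_rep (mult_op (\<lambda>t. f t + g t) F) t"
    unfolding plus_blinfun.rep_eq
    using L2_rep_add[of "mult_op f F" "mult_op g F"] mult_op_rep'[OF f, of F] mult_op_rep'[OF g, of F]
      mult_op_rep'[OF bounded_borel_add[OF f g], of F]
    by eventually_elim (simp add: algebra_simps)
qed

lemma mult_op_scaleC: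
  assumes f: "bounded_borel f"
  shows "mult_op f (scaleC c F) = scaleC c (mult_op f F)"
proof (rule L2_eqI)
  show "AE t in lborel. L2_rep (mult_op f (scaleC c F)) t = L2_rep (scaleC c (mult_op f F)) t"
    using L2_rep_scaleC[of c "F"] mult_op_rep'[OF f, of F] mult_op_rep'[OF f, of "scaleC c F"]
      L2_rep_scaleC[of c "mult_op f F"]
    by eventually_elim simp
qed

text \<open>Connects the constant symbols through which \<open>scale_op\<close> is defined with the
  scalar action on vectors.\<close>

lemma mult_op_const_apply: "mult_op (\<lambda>_. c) F = scaleC c F"
proof (rule L2_eqI)
  show "AE t in lborel. L2_rep (mult_op (\<lambda>_. c) F) t = L2_rep (scaleC c F) t"
    using mult_op_rep'[OF bounded_borel_const, of c F] L2_rep_scaleC[of c F]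
    by eventually_elim simp
qed

lemma mult_op_zero: "mult_op (\<lambda>_. 0) = 0"
  by (rule blinfun_eqI)
    (metis mult_op_const_apply of_real_0 scaleR_L2_def scaleR_zero_left zero_blinfun.rep_eq)

lemma cinner_mult_op:
  assumes f: "bounded_borel f"
  shows "cinner (mult_op f F) G = cinner F (mult_op (\<lambda>t. cnj (f t)) G)"
proof -
  have "(LINT t|lborel. L2_rep (mult_op f F) t * cnj (L2_rep G t)) =
      (LINT t|lborel. L2_rep F t * cnj (L2_rep (mult_op (\<lambda>t. cnj (f t)) G) t))"
  proof (rule integral_cong_AE)
    show "AE t in lborel. L2_rep (mult_op f F) t * cnj (L2_rep G t) =
        L2_rep F t * cnj (L2_rep (mult_op (\<lambda>t. cnj (f t)) G) t)"
      using mult_op_rep'[OF f, of F] mult_op_rep'[OF bounded_borel_cnj[OF f], of G]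
      by eventually_elim simp
  qed (auto intro: cnj_product_measurable)
  then show ?thesis by (simp add: cinner_def)
qed

lemma adj_mult_op: "bounded_borel f \<Longrightarrow> adj (mult_op f) = mult_op (\<lambda>t. cnj (f t))"
  by (rule adj_eqI) (rule cinner_mult_op)

section \<open>Norm estimates for multiplication operators\<close>

lemma norm_mult_op_le:
  assumes f: "f \<in> borel_measurable borel" "\<And>t. cmod (f t) \<le> K"
  shows "norm (mult_op f) \<le> K"
proof (rule norm_blinfun_bound)
  show K: "0 \<le> K" using f(2)[of 0] norm_ge_zero order_trans by blast
  fix F
  have int: "integrable lborel (\<lambda>t. (cmod (L2_rep F t))\<^sup>2)" for F
    using L2_rep_in[of F] unfolding sq_integrable_def by blast
  have "(LINT t|lborel. (cmod (L2_rep (mult_op f F) t))\<^sup>2) \<le> (LINT t|lborel. K\<^sup>2 * (cmod (L2_rep F t))\<^sup>2)"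
  proof (rule integral_mono_AE)
    show "AE t in lborel. (cmod (L2_rep (mult_op f F) t))\<^sup>2 \<le> K\<^sup>2 * (cmod (L2_rep F t))\<^sup>2"
      using mult_op_rep[OF f, of F]
      by eventually_elim (simp add: norm_mult power_mult_distrib mult_right_mono power_mono f)
  qed (use int in auto)
  then have "norm (mult_op f F) \<le> sqrt (K\<^sup>2 * (LINT t|lborel. (cmod (L2_rep F t))\<^sup>2))"
    by (simp add: norm_L2_eq)
  then show "norm (mult_op f F) \<le> K * norm F"
    using K by (simp add: norm_L2_eq real_sqrt_mult)
qed

text \<open>The operator is tested on the indicator of a piece of \<open>S\<close> of finite
  positive measure. With \<open>norm_mult_op_le\<close> this gives the part of the essential
  supremum formula from which the isometry below follows.\<close>

lemma norm_mult_op_ge: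
  assumes f: "bounded_borel f" and S: "S \<in> sets borel" "emeasure lborel S \<noteq> 0"
    and K: "\<And>t. t \<in> S \<Longrightarrow> K \<le> cmod (f t)" "0 \<le> K"
  shows "K \<le> norm (mult_op f)"
proof -
  \<comment> \<open>\<open>S\<close> may have infinite measure, and then its indicator is not square
    integrable. If all bounded pieces were null, so would be their countable union.\<close>
  have "\<exists>n::nat. emeasure lborel (S \<inter> {- real n..real n}) \<noteq> 0"
  proof (rule ccontr)
    assume "\<not> ?thesis"
    then have "(\<Union>n::nat. S \<inter> {- real n..real n}) \<in> null_sets lborel"
      using S by (intro null_sets_UN) auto
    moreover have "S \<subseteq> (\<Union>n::nat. S \<inter> {- real n..real n})"
    proof
      fix t assume "t \<in> S"
      moreover obtain n where "\<bar>t\<bar> \<le> real n" using real_arch_simple by blast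
      ultimately show "t \<in> (\<Union>n::nat. S \<inter> {- real n..real n})" by (auto simp: abs_le_iff) (metis minus_le_iff)
    qed
    ultimately have "S \<in> null_sets lborel"
      using S(1) null_sets_subset[of _ lborel S] by simp
    then show False using S by auto
  qed
  then obtain n :: nat where n: "emeasure lborel (S \<inter> {- real n..real n}) \<noteq> 0" by blast
  define T where "T = S \<inter> {- real n..real n}"
  define g :: "real \<Rightarrow> complex" where "g = indicator T"
  have T [measurable]: "T \<in> sets borel" using S by (auto simp: T_def)
  have "emeasure lborel T \<le> emeasure lborel {- real n..real n}"
    by (intro emeasure_mono) (auto simp: T_def)
  also have "\<dots> < \<infinity>" by simp
  finally have fin: "emeasure lborel T < \<infinity>" .
  have g2: "(\<lambda>t. (cmod (g t))\<^sup>2) = indicat_real T"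
    by (auto simp: g_def indicator_def)
  have g: "g \<in> sq_integrable"
    unfolding sq_integrable_def mem_Collect_eq g2
    using T fin by (auto simp: g_def intro!: borel_measurable_indicator)
  define F where "F = L2_class g"
  have rep: "AE t in lborel. L2_rep F t = g t" unfolding F_def by (rule L2_rep_class[OF g])
  have "(LINT t|lborel. (cmod (L2_rep F t))\<^sup>2) = (LINT t|lborel. indicat_real T t)"
    by (rule integral_cong_AE) (use rep g2 in \<open>auto simp: fun_eq_iff\<close>)
  also have "\<dots> = measure lborel T" by simp
  finally have nF: "norm F = sqrt (measure lborel T)" by (simp add: norm_L2_eq)
  have "0 < measure lborel T"
    using fin n unfolding T_def[symmetric]
    by (metis emeasure_eq_ennreal_measure ennreal_0 measure_nonneg less_irrefl order_le_less infinity_ennreal_def)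
  then have pos: "0 < norm F" by (simp add: nF)
  have int: "integrable lborel (\<lambda>t. (cmod (L2_rep F t))\<^sup>2)" for F
    using L2_rep_in[of F] unfolding sq_integrable_def by blast
  have "(LINT t|lborel. K\<^sup>2 * (cmod (L2_rep F t))\<^sup>2) \<le> (LINT t|lborel. (cmod (L2_rep (mult_op f F) t))\<^sup>2)"
  proof (rule integral_mono_AE)
    show "AE t in lborel. K\<^sup>2 * (cmod (L2_rep F t))\<^sup>2 \<le> (cmod (L2_rep (mult_op f F) t))\<^sup>2"
      using mult_op_rep'[OF f, of F] rep
    proof eventually_elim
      case (elim t)
      show ?case
      proof (cases "t \<in> T")
        case True
        then have "K\<^sup>2 \<le> (cmod (f t))\<^sup>2" using K by (intro power_mono) (auto simp: T_def)
        then show ?thesis using elim True by (simp add: g_def)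
      qed (use elim in \<open>simp add: g_def\<close>)
    qed
  qed (use int in auto)
  then have "sqrt (K\<^sup>2 * (LINT t|lborel. (cmod (L2_rep F t))\<^sup>2)) \<le> norm (mult_op f F)"
    by (simp add: norm_L2_eq)
  then have "K * norm F \<le> norm (mult_op f F)"
    using K by (simp add: norm_L2_eq real_sqrt_mult)
  also have "\<dots> \<le> norm (mult_op f) * norm F" by (rule norm_blinfun)
  finally show ?thesis using pos by simp
qed

section \<open>Algebras of multiplication operators with a compact model\<close>

text \<open>The value 0 on the negative half-line makes the multiplication operator act on
  \<open>H\<close>; the constant 1 on the model yields the projection onto \<open>H\<close>, which
  is the unit.\<close>

definition pullback :: "(real \<Rightarrow> 'x) \<Rightarrow> ('x \<Rightarrow> complex) \<Rightarrow> real \<Rightarrow> complex"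
  where "pullback p c t = (if 0 \<le> t then c (p t) else 0)"

definition model_op :: "(real \<Rightarrow> 'x) \<Rightarrow> ('x \<Rightarrow> complex) \<Rightarrow> (L2 \<Rightarrow>\<^sub>L L2)"
  where "model_op p c = mult_op (pullback p c)"

text \<open>The map \<open>p\<close> may jump, so measurability of pullbacks is an assumption rather
  than a consequence of continuity. The last assumption says that every relatively open part of
  \<open>M\<close> is seen by a set of positive measure, since nonempty open sets of reals are not
  null.\<close>

locale compact_model =
  fixes M :: "'x::t2_space set" and p :: "real \<Rightarrow> 'x"
  assumes compact: "compact M"
    and p_in: "0 \<le> t \<Longrightarrow> p t \<in> M"
    and measurable_pullback: "continuous_on M c \<Longrightarrow> pullback p c \<in> borel_measurable borel"
    and essentially_dense: "open V \<Longrightarrow> V \<inter> M \<noteq> {} \<Longrightarrow>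
      \<exists>A. open A \<and> A \<noteq> {} \<and> A \<subseteq> {0..} \<and> p ` A \<subseteq> V"
begin

definition model_algebra :: "(L2 \<Rightarrow>\<^sub>L L2) set"
  where "model_algebra = model_op p ` {c. continuous_on M c}"

lemma nonempty: "M \<noteq> {}"
  using p_in[of 0] by auto

lemma bounded_continuous:
  assumes "continuous_on M (c :: 'x \<Rightarrow> complex)"
  obtains K where "0 \<le> K" "\<And>q. q \<in> M \<Longrightarrow> cmod (c q) \<le> K"
  using compact_imp_bounded[OF compact_continuous_image[OF assms compact]] nonempty
  by (auto simp: bounded_iff) (meson norm_ge_zero order_trans)

lemma pullback_le:
  assumes "\<And>q. q \<in> M \<Longrightarrow> cmod (c q) \<le> K"
  shows "cmod (pullback p c t) \<le> K"
proof -
  have "0 \<le> K" using assms[OF p_in[of 0]] norm_ge_zero order_trans by blast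
  then show ?thesis using assms p_in by (auto simp: pullback_def)
qed

lemma bounded_borel_pullback:
  assumes "continuous_on M c"
  shows "bounded_borel (pullback p c)"
proof -
  obtain K where K: "\<And>q. q \<in> M \<Longrightarrow> cmod (c q) \<le> K"
    using bounded_continuous[OF assms] by blast
  show ?thesis
    by (rule bounded_borelI[OF measurable_pullback[OF assms] pullback_le[OF K]])
qed

lemma model_op_cong: "(\<And>q. q \<in> M \<Longrightarrow> c q = d q) \<Longrightarrow> model_op p c = model_op p d"
  unfolding model_op_def by (rule arg_cong[where f = mult_op]) (auto simp: pullback_def p_in)

lemma model_op_add:
  assumes "continuous_on M c" "continuous_on M d"
  shows "model_op p c + model_op p d = model_op p (\<lambda>q. c q + d q)"
  unfolding model_op_def
    mult_op_add[OF bounded_borel_pullback[OF assms(1)] bounded_borel_pullback[OF assms(2)]]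
  by (rule arg_cong[where f = mult_op]) (auto simp: pullback_def)

lemma model_op_mult:
  assumes "continuous_on M c" "continuous_on M d"
  shows "model_op p c o\<^sub>L model_op p d = model_op p (\<lambda>q. c q * d q)"
  unfolding model_op_def
    mult_op_comp[OF bounded_borel_pullback[OF assms(1)] bounded_borel_pullback[OF assms(2)]]
  by (rule arg_cong[where f = mult_op]) (auto simp: pullback_def)

lemma scale_model_op:
  assumes "continuous_on M c"
  shows "scale_op k (model_op p c) = model_op p (\<lambda>q. k * c q)"
  unfolding model_op_def scale_op_def
    mult_op_comp[OF bounded_borel_const bounded_borel_pullback[OF assms]]
  by (rule arg_cong[where f = mult_op]) (auto simp: pullback_def)

lemma adj_model_op:
  assumes "continuous_on M c"
  shows "adj (model_op p c) = model_op p (\<lambda>q. cnj (c q))"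
  unfolding model_op_def adj_mult_op[OF bounded_borel_pullback[OF assms]]
  by (rule arg_cong[where f = mult_op]) (auto simp: pullback_def)

lemma model_op_diff:
  assumes "continuous_on M c" "continuous_on M d"
  shows "model_op p c - model_op p d = model_op p (\<lambda>q. c q - d q)"
proof -
  have "model_op p (\<lambda>q. c q - d q) + model_op p d = model_op p c"
    using assms by (simp add: model_op_add continuous_on_diff)
  then show ?thesis by (simp add: algebra_simps)
qed

section \<open>Isometry of the embedding of the continuous functions and closedness of its
  image\<close>

lemma norm_model_op_le:
  assumes "continuous_on M c" "\<And>q. q \<in> M \<Longrightarrow> cmod (c q) \<le> K"
  shows "norm (model_op p c) \<le> K"
  unfolding model_op_def
  by (rule norm_mult_op_le[OF measurable_pullback[OF assms(1)] pullback_le[OF assms(2)]])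

text \<open>Near \<open>q\<close> the modulus of \<open>c\<close> stays above any smaller bound, and
  by essential density a nonempty open set of times is sent there; its positive measure lets
  \<open>norm_mult_op_ge\<close> apply.\<close>

lemma norm_model_op_ge:
  assumes c: "continuous_on M c" and q: "q \<in> M"
  shows "cmod (c q) \<le> norm (model_op p c)"
\<comment> \<open>Working with \<open>K\<close> strictly below the modulus makes the superlevel set
  relatively open.\<close>
proof (rule dense_le)
  fix K assume K: "K < cmod (c q)"
  show "K \<le> norm (model_op p c)"
  proof (cases "0 \<le> K")
    case True
    have "continuous_on M (\<lambda>q. cmod (c q))" using c by (intro continuous_intros)
    then obtain V where V: "open V" "V \<inter> M = (\<lambda>q. cmod (c q)) -` {K<..} \<inter> M"
      using open_greaterThan[of K] unfolding continuous_on_open_invariant by blast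
    have "V \<inter> M \<noteq> {}" unfolding V(2) using q K by auto
    then obtain A where A: "open A" "A \<noteq> {}" "A \<subseteq> {0..}" "p ` A \<subseteq> V"
      using essentially_dense[OF V(1)] by blast
    have "K \<le> cmod (pullback p c t)" if "t \<in> A" for t
    proof -
      have "0 \<le> t" using A that by auto
      then have "p t \<in> V \<inter> M" using A that p_in by auto
      then show ?thesis unfolding V(2) using \<open>0 \<le> t\<close> by (auto simp: pullback_def)
    qed
    moreover have "emeasure lborel A \<noteq> 0"
      using open_not_negligible[OF A(1,2)] null_sets_completionI[of A lborel] A(1)
      by (auto simp: negligible_iff_null_sets null_sets_def)
    ultimately show ?thesis
      unfolding model_op_def using A(1) True
      by (intro norm_mult_op_ge[OF bounded_borel_pullback[OF c]]) auto
  qed (use norm_ge_zero[of "model_op p c"] in linarith)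
qed

lemma model_op_inject:
  assumes "continuous_on M c" "continuous_on M d" "q \<in> M" "model_op p c = model_op p d"
  shows "c q = d q"
  using norm_model_op_ge[of "\<lambda>q. c q - d q" q] assms model_op_diff[of c d]
  by (simp add: continuous_on_diff)

text \<open>By the isometry, a convergent sequence of operators has uniformly Cauchy symbols. Their
  uniform limit is continuous and is the symbol of the limit operator.\<close>

lemma closed_model_algebra: "closed model_algebra"
  unfolding closed_sequential_limits
proof (intro allI impI, elim conjE)
  fix T l assume T: "\<forall>n. T n \<in> model_algebra" and lim: "T \<longlonglongrightarrow> l"
  obtain c where c: "\<And>n. continuous_on M (c n)" "\<And>n. T n = model_op p (c n)"
    using T unfolding model_algebra_def image_iff by (metis mem_Collect_eq)
  have "uniformly_Cauchy_on M c"
  proof (rule uniformly_Cauchy_onI)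
    fix e :: real assume "0 < e"
    moreover have "Cauchy T" using lim by (rule LIMSEQ_imp_Cauchy)
    ultimately obtain N where N: "\<And>m n. m \<ge> N \<Longrightarrow> n \<ge> N \<Longrightarrow> dist (T m) (T n) < e"
      unfolding Cauchy_def by blast
    have "dist (c m q) (c n q) < e" if "q \<in> M" "m \<ge> N" "n \<ge> N" for q m n
    proof -
      have "dist (c m q) (c n q) \<le> dist (T m) (T n)"
        using norm_model_op_ge[of "\<lambda>q. c m q - c n q" q] c that
        by (simp add: dist_norm model_op_diff continuous_on_diff)
      then show ?thesis using N that by fastforce
    qed
    then show "\<exists>N. \<forall>q\<in>M. \<forall>m\<ge>N. \<forall>n\<ge>N. dist (c m q) (c n q) < e" by blast
  qed
  then obtain d where d: "uniform_limit M c d sequentially"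
    using Cauchy_uniformly_convergent uniformly_convergent_on_def by blast
  have cd: "continuous_on M d"
    by (rule uniform_limit_theorem[OF _ d]) (auto simp: c)
  have "T \<longlonglongrightarrow> model_op p d"
  proof (rule metric_LIMSEQ_I)
    fix e :: real assume e: "0 < e"
    then have "\<forall>\<^sub>F n in sequentially. \<forall>q\<in>M. dist (c n q) (d q) < e / 2"
      using d unfolding uniform_limit_iff by (meson half_gt_zero)
    then obtain N where N: "\<And>n q. n \<ge> N \<Longrightarrow> q \<in> M \<Longrightarrow> dist (c n q) (d q) < e / 2"
      unfolding eventually_sequentially by blast
    have "dist (T n) (model_op p d) < e" if "n \<ge> N" for n
    proof -
      have "dist (T n) (model_op p d) \<le> e / 2"
        unfolding c dist_norm model_op_diff[OF c(1) cd]
        using N[OF that] by (intro norm_model_op_le continuous_on_diff c cd) (auto simp: dist_norm less_imp_le)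
      then show ?thesis using e by simp
    qed
    then show "\<exists>N. \<forall>n\<ge>N. dist (T n) (model_op p d) < e" by blast
  qed
  then have "l = model_op p d" using lim LIMSEQ_unique by blast
  then show "l \<in> model_algebra" using cd by (auto simp: model_algebra_def)
qed

lemma cstar_algebra_model: "cstar_algebra model_algebra"
  unfolding cstar_algebra_def
proof (intro conjI ballI allI)
  show "model_algebra \<subseteq> Collect complex_linear"
    by (auto simp: model_algebra_def complex_linear_def model_op_def
        intro!: mult_op_scaleC bounded_borel_pullback)
  have "0 = model_op p (\<lambda>_. 0)"
    by (simp add: model_op_def pullback_def[abs_def] mult_op_zero)
  then show "0 \<in> model_algebra" by (auto simp: model_algebra_def)
  show "closed model_algebra" by (rule closed_model_algebra)
qed (auto simp: model_algebra_def model_op_add model_op_mult scale_model_op adj_model_op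
    intro!: imageI continuous_intros)

text \<open>Inside any C*-algebra containing \<open>S\<close>, the real symbols form an algebra with
  constants that separates points. Stone-Weierstrass and norm closedness then yield all real
  symbols, and linear combination yields the complex ones.\<close>

lemma cstar_generated_model:
  assumes sub: "S \<subseteq> model_algebra" and one: "model_op p (\<lambda>_. 1) \<in> S"
    and sep: "\<And>q r. q \<in> M \<Longrightarrow> r \<in> M \<Longrightarrow> q \<noteq> r \<Longrightarrow>
      \<exists>g :: 'x \<Rightarrow> real. continuous_on M g \<and> model_op p (\<lambda>q. of_real (g q)) \<in> S \<and> g q \<noteq> g r"
  shows "cstar_generated S = model_algebra"
proof
  show "cstar_generated S \<subseteq> model_algebra"
    unfolding cstar_generated_def using cstar_algebra_model sub by blast
  show "model_algebra \<subseteq> cstar_generated S"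
    unfolding cstar_generated_def
  proof (intro subsetI InterI)
    fix T C assume "T \<in> model_algebra" and "C \<in> {C. cstar_algebra C \<and> S \<subseteq> C}"
    then obtain c where c: "continuous_on M c" "T = model_op p c"
      and C: "cstar_algebra C" "S \<subseteq> C" by (auto simp: model_algebra_def)
    \<comment> \<open>The class of real functions to which Stone-Weierstrass is applied; it refers
      to the arbitrary algebra \<open>C\<close>, not only to \<open>S\<close>.\<close>
    define P where "P g \<longleftrightarrow> continuous_on M g \<and> model_op p (\<lambda>q. of_real (g q)) \<in> C"
      for g :: "'x \<Rightarrow> real"
    have add: "A + B \<in> C" "A o\<^sub>L B \<in> C" if "A \<in> C" "B \<in> C" for A B
      using that C by (auto simp: cstar_algebra_def)
    have scale: "scale_op k A \<in> C" if "A \<in> C" for A k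
      using that C by (auto simp: cstar_algebra_def)
    have closure: "closed C" using C by (simp add: cstar_algebra_def)
    have real: "model_op p (\<lambda>q. of_real (f q)) \<in> C" if f: "continuous_on M f" for f :: "'x \<Rightarrow> real"
    proof -
      have approx: "\<exists>g. P g \<and> (\<forall>q\<in>M. \<bar>f q - g q\<bar> < e)" if "0 < e" for e
      proof (rule Stone_Weierstrass_HOL[where P = P, OF compact _ _ _ _ _ f that])
        fix k :: real
        have "scale_op k (model_op p (\<lambda>_. 1)) \<in> C" using one C scale by blast
        then show "P (\<lambda>_. k)" by (simp add: P_def scale_model_op)
      next
        fix g h assume *: "P g \<and> P h"
        then have "continuous_on M (\<lambda>q. complex_of_real (g q))"
          "continuous_on M (\<lambda>q. complex_of_real (h q))"
          by (auto simp: P_def intro!: continuous_intros)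
        note mo = model_op_add[OF this] model_op_mult[OF this]
        show "P (\<lambda>q. g q + h q)"
          using * add mo(1) by (auto simp: P_def intro!: continuous_intros) metis
        show "P (\<lambda>q. g q * h q)"
          using * add mo(2) by (auto simp: P_def intro!: continuous_intros) metis
      next
        fix q r assume "q \<in> M \<and> r \<in> M \<and> q \<noteq> r"
        then show "\<exists>g. P g \<and> g q \<noteq> g r" using sep[of q r] C unfolding P_def by blast
      qed (auto simp: P_def)
      \<comment> \<open>Errors \<open>1 / Suc n\<close> turn the approximation into a sequence, so
        that closedness of \<open>C\<close> can be used through limits.\<close>
      then obtain g where g: "\<And>n::nat. P (g n)"
        "\<And>n q. q \<in> M \<Longrightarrow> \<bar>f q - g n q\<bar> < 1 / real (Suc n)"
      proof -
        have "\<forall>n::nat. \<exists>g. P g \<and> (\<forall>q\<in>M. \<bar>f q - g q\<bar> < 1 / real (Suc n))"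
          using approx by simp
        then show ?thesis using that by metis
      qed
      have in_C: "model_op p (\<lambda>q. of_real (g n q)) \<in> C" for n using g by (simp add: P_def)
      have cont: "continuous_on M (\<lambda>q. complex_of_real (g n q))" "continuous_on M (\<lambda>q. complex_of_real (f q))" for n
        using g(1)[of n] f by (auto simp: P_def intro!: continuous_intros)
      have "(\<lambda>n. model_op p (\<lambda>q. of_real (g n q))) \<longlonglongrightarrow> model_op p (\<lambda>q. of_real (f q))"
      proof (rule metric_LIMSEQ_I)
        fix e :: real assume "0 < e"
        then obtain N where N: "1 / real (Suc N) < e" using nat_approx_posE by blast
        have "dist (model_op p (\<lambda>q. of_real (g n q))) (model_op p (\<lambda>q. of_real (f q))) < e"
          if "n \<ge> N" for n
        proof -
          have "dist (model_op p (\<lambda>q. of_real (g n q))) (model_op p (\<lambda>q. of_real (f q))) \<le> 1 / real (Suc n)"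
            unfolding dist_norm model_op_diff[OF cont]
          proof (rule norm_model_op_le)
            fix q assume "q \<in> M"
            then show "cmod (complex_of_real (g n q) - complex_of_real (f q)) \<le> 1 / real (Suc n)"
              using g(2)[of q n] unfolding of_real_diff[symmetric] norm_of_real by simp
          qed (intro continuous_intros cont)
          also have "\<dots> \<le> 1 / real (Suc N)" using that by (simp add: field_simps)
          finally show ?thesis using N by simp
        qed
        then show "\<exists>N. \<forall>n\<ge>N. dist (model_op p (\<lambda>q. of_real (g n q))) (model_op p (\<lambda>q. of_real (f q))) < e"
          by blast
      qed
      then show ?thesis
        by (rule Topological_Spaces.closed_sequentially[OF closure in_C])
    qed
    \<comment> \<open>A complex symbol is assembled from its real and imaginary parts inside
      \<open>C\<close>.\<close>
    have cc: "continuous_on M (\<lambda>q. Re (c q))" "continuous_on M (\<lambda>q. Im (c q))"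
      using c by (auto intro!: continuous_intros)
    have "model_op p (\<lambda>q. of_real (Re (c q))) + scale_op \<i> (model_op p (\<lambda>q. of_real (Im (c q)))) \<in> C"
      using cc by (intro add scale real)
    moreover have "model_op p (\<lambda>q. of_real (Re (c q))) + scale_op \<i> (model_op p (\<lambda>q. of_real (Im (c q)))) = T"
      using cc by (simp add: c scale_model_op model_op_add continuous_intros complex_eq[symmetric])
    ultimately show "T \<in> C" by simp
  qed
qed

section \<open>Characters of the model algebra and its spectrum\<close>

definition point_character :: "'x \<Rightarrow> (L2 \<Rightarrow>\<^sub>L L2) \<Rightarrow> complex"
  where "point_character q =
    (\<lambda>T\<in>model_algebra. (SOME c. continuous_on M c \<and> T = model_op p c) q)"

text \<open>The symbol picked by \<open>SOME\<close> may differ from \<open>c\<close> outside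
  \<open>M\<close>, but by \<open>model_op_inject\<close> it agrees with \<open>c\<close> on
  \<open>M\<close>, so the evaluation is well defined.\<close>

lemma point_character_eq:
  assumes "continuous_on M c" "q \<in> M"
  shows "point_character q (model_op p c) = c q"
proof -
  define d where "d = (SOME d. continuous_on M d \<and> model_op p c = model_op p d)"
  have "continuous_on M d \<and> model_op p c = model_op p d"
    unfolding d_def by (rule someI[where x = c]) (use assms in auto)
  then have "d q = c q" using model_op_inject assms by metis
  then show ?thesis using assms by (simp add: point_character_def model_algebra_def d_def)
qed

lemma point_character_in:
  assumes q: "q \<in> M"
  shows "point_character q \<in> characters model_algebra"
  unfolding characters_def mem_Collect_eq
proof (intro conjI ballI allI)
  show "point_character q \<in> extensional model_algebra" by (simp add: point_character_def)
  show "\<exists>T\<in>model_algebra. point_character q T \<noteq> 0"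
    by (rule bexI[where x = "model_op p (\<lambda>_. 1)"])
      (use q in \<open>auto simp: point_character_eq model_algebra_def\<close>)
qed (use q in \<open>auto simp: model_algebra_def model_op_add model_op_mult scale_model_op
    point_character_eq continuous_intros\<close>)

text \<open>
  A character missing every point evaluation would, by compactness, annihilate a finite sum of
  squares \<open>\<bar>c\<^sub>1\<bar>\<^sup>2 + \<dots> + \<bar>c\<^sub>n\<bar>\<^sup>2\<close> without zeros on the model, hence the unit.
\<close>

lemma character_is_point:
  assumes x: "x \<in> characters model_algebra"
  shows "\<exists>q\<in>M. x = point_character q"
proof -
  define X where "X c = x (model_op p c)" for c
  have in_alg: "model_op p c \<in> model_algebra" if "continuous_on M c" for c
    using that by (auto simp: model_algebra_def)
  have add: "X (\<lambda>q. c q + d q) = X c + X d" and mult: "X (\<lambda>q. c q * d q) = X c * X d"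
    if "continuous_on M c" "continuous_on M d" for c d
    using x that in_alg unfolding X_def characters_def
    by (simp_all add: model_op_add[symmetric] model_op_mult[symmetric])
  have scale: "X (\<lambda>q. k * c q) = k * X c" if "continuous_on M c" for c k
    using x that in_alg unfolding X_def characters_def
    by (simp add: scale_model_op[symmetric])
  obtain c0 where c0: "continuous_on M c0" "X c0 \<noteq> 0"
    using x unfolding characters_def X_def model_algebra_def by blast
  \<comment> \<open>Cancel the nonzero factor in \<open>X c0 = X 1 * X c0\<close>.\<close>
  have one: "X (\<lambda>_. 1) = 1"
    using mult[of "\<lambda>_. 1" c0] c0 by simp
  have "\<exists>q\<in>M. \<forall>c. continuous_on M c \<longrightarrow> X c = 0 \<longrightarrow> c q = 0"
  proof (rule ccontr)
    assume "\<not> ?thesis"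
    \<comment> \<open>For every point, a symbol killed by the character that does not vanish
      there.\<close>
    then obtain k where k: "\<And>q. q \<in> M \<Longrightarrow> continuous_on M (k q) \<and> X (k q) = 0 \<and> k q q \<noteq> 0"
      by metis
    have "\<exists>V. open V \<and> V \<inter> M = k q -` (- {0}) \<inter> M" if "q \<in> M" for q
      using k[OF that] open_Compl[OF closed_singleton[of "0::complex"]]
      unfolding continuous_on_open_invariant by blast
    then obtain V where V: "\<And>q. q \<in> M \<Longrightarrow> open (V q) \<and> V q \<inter> M = k q -` (- {0}) \<inter> M" by metis
    have "M \<subseteq> (\<Union>q\<in>M. V q)" using V k by blast
    then obtain F where F: "F \<subseteq> M" "finite F" "M \<subseteq> (\<Union>q\<in>F. V q)"
      using compactE_image[OF compact, of M V] V by blast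
    define s where "s G r = (\<Sum>q\<in>G. k q r * cnj (k q r))" for G r
    have s: "continuous_on M (s G) \<and> X (s G) = 0" if "finite G" "G \<subseteq> M" for G
      using that
    proof (induction G)
      case empty
      have "X (\<lambda>_. 0) = 0" using scale[of "\<lambda>_. 1" 0] by simp
      then show ?case by (simp add: s_def[abs_def])
    next
      case (insert q G)
      have "s (insert q G) = (\<lambda>r. k q r * cnj (k q r) + s G r)"
        using insert by (auto simp: s_def)
      moreover have "continuous_on M (\<lambda>r. cnj (k q r))"
        using k insert by (auto intro!: continuous_intros)
      moreover from this have "continuous_on M (\<lambda>r. k q r * cnj (k q r))"
        using k insert by (auto intro!: continuous_intros)
      \<comment> \<open>Multiplicativity kills the new summand, because its factor
        \<open>k q\<close> is already killed.\<close>
      ultimately show ?case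
        using insert k add[of "\<lambda>r. k q r * cnj (k q r)" "s G"] mult[of "k q" "\<lambda>r. cnj (k q r)"]
        by (auto intro!: continuous_intros)
    qed
    have pos: "s F r \<noteq> 0" if r: "r \<in> M" for r
    proof -
      obtain q where q: "q \<in> F" "r \<in> V q" using F r by auto
      then have "k q r \<noteq> 0" using V F r by blast
      then have "0 < (\<Sum>q\<in>F. (cmod (k q r))\<^sup>2)"
        using q F by (intro sum_pos2[where i = q]) auto
      moreover have "s F r = of_real (\<Sum>q\<in>F. (cmod (k q r))\<^sup>2)"
        by (simp only: s_def of_real_sum complex_norm_square)
      ultimately show ?thesis by (simp only: of_real_eq_0_iff)
    qed
    have sF: "continuous_on M (s F)" "X (s F) = 0" using s F by auto
    \<comment> \<open>Since \<open>s F\<close> has no zeros on \<open>M\<close>, its inverse is a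
      continuous symbol; the product represents the unit, on which \<open>X\<close> is 1.\<close>
    have "X (\<lambda>r. s F r * inverse (s F r)) = 0"
      using mult[OF sF(1) continuous_on_inverse[OF sF(1)]] pos sF by simp
    moreover have "model_op p (\<lambda>r. s F r * inverse (s F r)) = model_op p (\<lambda>_. 1)"
      using pos by (intro model_op_cong) auto
    ultimately show False using one by (simp add: X_def)
  qed
  then obtain q where q: "q \<in> M" "\<And>c. continuous_on M c \<Longrightarrow> X c = 0 \<Longrightarrow> c q = 0" by blast
  have X: "X c = c q" if c: "continuous_on M c" for c
  proof -
    \<comment> \<open>Subtracting the constant \<open>X c\<close> puts \<open>c\<close> into the
      kernel of \<open>X\<close>, all of whose elements vanish at \<open>q\<close>.\<close>
    have "X (\<lambda>r. c r + (- X c) * 1) = 0"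
      using c one add[of c "\<lambda>_. (- X c) * 1"] scale[of "\<lambda>_. 1" "- X c"] by simp
    then have "c q + (- X c) * 1 = 0" using q(2)[of "\<lambda>r. c r + (- X c) * 1"] c by (simp add: continuous_intros)
    then show ?thesis by simp
  qed
  have "x = point_character q"
  proof (rule extensionalityI[where A = model_algebra])
    show "x \<in> extensional model_algebra" using x by (simp add: characters_def)
    show "point_character q \<in> extensional model_algebra" by (simp add: point_character_def)
    fix T assume "T \<in> model_algebra"
    then obtain c where "continuous_on M c" "T = model_op p c" by (auto simp: model_algebra_def)
    then show "x T = point_character q T"
      using X q by (simp add: X_def point_character_eq)
  qed
  then show ?thesis using q by blast
qed

text \<open>A continuous bijection from a compact space to a Hausdorff space is a homeomorphism.
  Continuity is tested at each operator separately, surjectivity is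
  \<open>character_is_point\<close>, and injectivity comes from separation.\<close>

theorem spectrum_model_algebra:
  assumes sep: "\<And>q r. q \<in> M \<Longrightarrow> r \<in> M \<Longrightarrow> q \<noteq> r \<Longrightarrow>
      \<exists>c :: 'x \<Rightarrow> complex. continuous_on M c \<and> c q \<noteq> c r"
  shows "homeomorphic_map (top_of_set M) (spectrum model_algebra) point_character"
proof (rule continuous_imp_homeomorphic_map)
  have top: "topspace (spectrum model_algebra) = characters model_algebra"
    by (auto simp: spectrum_def characters_def PiE_def)
  show "continuous_map (top_of_set M) (spectrum model_algebra) point_character"
    unfolding spectrum_def continuous_map_in_subtopology
  proof (intro conjI)
    show "continuous_map (top_of_set M) (product_topology (\<lambda>_. euclidean) model_algebra) point_character"
      unfolding continuous_map_componentwise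
    proof (intro conjI ballI)
      show "point_character ` topspace (top_of_set M) \<subseteq> extensional model_algebra"
        by (auto simp: point_character_def)
      fix T assume "T \<in> model_algebra"
      then obtain c where c: "continuous_on M c" "T = model_op p c" by (auto simp: model_algebra_def)
      have "continuous_on M (\<lambda>q. point_character q T)"
        by (rule continuous_on_eq[OF c(1)]) (simp add: c point_character_eq)
      then show "continuous_map (top_of_set M) euclidean (\<lambda>q. point_character q T)" by simp
    qed
  qed (auto simp: point_character_in)
  show "compact_space (top_of_set M)" using compact by (simp add: compact_space_subtopology)
  show "Hausdorff_space (spectrum model_algebra)"
    unfolding spectrum_def by (simp add: Hausdorff_space_subtopology Hausdorff_space_product_topology)
  show "point_character ` topspace (top_of_set M) = topspace (spectrum model_algebra)"
    unfolding top using point_character_in character_is_point by auto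
  show "inj_on point_character (topspace (top_of_set M))"
    using sep point_character_eq by (auto simp: inj_on_def) metis
qed

end

section \<open>Lifts of circle homeomorphisms\<close>

abbreviation circ :: "real \<Rightarrow> complex"
  where "circ t \<equiv> cis (2 * pi * t)"

lemma circ_eq_iff: "circ s = circ t \<longleftrightarrow> (\<exists>n::int. s = t + of_int n)"
proof -
  have "circ s = circ t \<longleftrightarrow> (\<exists>n::int. \<i> * of_real (2 * pi * s) = \<i> * of_real (2 * pi * t) + (of_int (2 * n) * pi) * \<i>)"
    unfolding cis_conv_exp exp_eq ..
  also have "\<dots> \<longleftrightarrow> (\<exists>n::int. s = t + of_int n)"
  proof (intro arg_cong[where f = Ex] ext)
    fix n :: int
    have "\<i> * of_real (2 * pi * s) = \<i> * of_real (2 * pi * t) + (of_int (2 * n) * pi) * \<i> \<longleftrightarrow>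
        \<i> * of_real (2 * pi * s) = \<i> * of_real (2 * pi * (t + of_int n))"
      by (simp add: algebra_simps)
    also have "\<dots> \<longleftrightarrow> s = t + of_int n"
      unfolding mult_cancel_left of_real_eq_iff by simp
    finally show "(\<i> * of_real (2 * pi * s) = \<i> * of_real (2 * pi * t) + (of_int (2 * n) * pi) * \<i>) = (s = t + of_int n)" .
  qed
  finally show ?thesis .
qed

lemma circ_surj:
  assumes "z \<in> sphere 0 1"
  obtains t where "z = circ t"
proof -
  have "z = circ (Arg2pi z / (2 * pi))"
    using assms complex_norm_eq_1_exp[of z] by (simp add: cis_conv_exp)
  then show ?thesis by (rule that)
qed

lemma circ_image_period:
  assumes "a + 1 \<le> b"
  shows "circ ` {a..b} = sphere 0 1"
proof
  show "sphere 0 1 \<subseteq> circ ` {a..b}"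
  proof
    fix z :: complex assume "z \<in> sphere 0 1"
    then obtain t where t: "z = circ t" by (rule circ_surj)
    \<comment> \<open>The ceiling moves \<open>t\<close> into \<open>[a, a + 1)\<close> without
      changing its image on the circle.\<close>
    define s where "s = t + of_int \<lceil>a - t\<rceil>"
    have "circ s = circ t" unfolding circ_eq_iff s_def by blast
    moreover have "a \<le> s" "s \<le> b" using assms unfolding s_def by linarith+
    ultimately show "z \<in> circ ` {a..b}" using t by (metis atLeastAtMost_iff image_eqI)
  qed
qed auto

text \<open>On \<open>{0..1}\<close> the covering is a continuous closed surjection onto the circle,
  hence a quotient map, and a periodic function is constant on its fibres.\<close>

lemma periodic_factors_through_circle:
  fixes a :: "real \<Rightarrow> complex"
  assumes a: "continuous_on UNIV a" "\<And>t. a (t + 1) = a t"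
  obtains b where "continuous_on (sphere 0 1) b" "\<And>t. b (circ t) = a t"
proof -
  have per: "a (t + of_int n) = a t" for t and n :: int
  proof (induction n rule: int_induct[where k = 0])
    case (step1 i)
    then show ?case using a(2)[of "t + of_int i"] by (simp add: add.assoc)
  next
    case (step2 i)
    then show ?case using a(2)[of "t + of_int (i - 1)"] by (simp add: add.assoc)
  qed simp
  have "quotient_map (top_of_set {0..1}) (top_of_set (sphere 0 1)) circ"
  proof (rule continuous_closed_imp_quotient_map)
    show c: "continuous_map (top_of_set {0..1}) (top_of_set (sphere 0 1)) circ"
      by (auto intro!: continuous_intros)
    show "closed_map (top_of_set {0..1}) (top_of_set (sphere 0 1)) circ"
      by (rule continuous_imp_closed_map[OF c])
        (auto simp: compact_space_subtopology Hausdorff_space_subtopology)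
    show "circ ` topspace (top_of_set {0..1}) = topspace (top_of_set (sphere 0 1))"
      using circ_image_period[of 0 1] by simp
  qed
  moreover have "continuous_map (top_of_set {0..1}) euclidean a"
    using a by (auto intro: continuous_on_subset)
  moreover have "a s = a t" if "circ s = circ t" for s t
    using that per by (auto simp: circ_eq_iff)
  ultimately have "\<exists>b. continuous_map (top_of_set (sphere 0 1)) euclidean b \<and>
      (\<forall>t\<in>{0..1}. b (circ t) = a t)"
    by (rule quotient_map_lift_exists[of "top_of_set {0..1}" "top_of_set (sphere 0 1)" circ euclidean a]) auto
  then obtain b where b: "continuous_map (top_of_set (sphere 0 1)) euclidean b"
    "\<And>t. t \<in> {0..1} \<Longrightarrow> b (circ t) = a t"
    by blast
  have "b (circ t) = a t" for t
  proof -
    have t: "t = frac t + of_int \<lfloor>t\<rfloor>" by (simp add: frac_def)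
    have "circ t = circ (frac t)" unfolding circ_eq_iff using t by blast
    moreover have "a t = a (frac t)" using per[of "frac t" "\<lfloor>t\<rfloor>"] t by metis
    moreover have "b (circ (frac t)) = a (frac t)"
      by (rule b(2)) (simp add: frac_lt_1 less_imp_le)
    ultimately show ?thesis by metis
  qed
  then show ?thesis using b(1) that by auto
qed

text \<open>Levels are compared through the finite thresholds below them, which treats finite and
  infinite levels alike.\<close>

lemma enat_eqI:
  assumes "\<And>k. enat k \<le> m \<longleftrightarrow> enat k \<le> n"
  shows "m = n"
proof (cases m; cases n)
  fix i j assume "m = enat i" "n = enat j"
  then show ?thesis using assms[of i] assms[of j] by simp
next
  fix i assume "m = enat i" "n = \<infinity>"
  then show ?thesis using assms[of "Suc i"] by simp
next
  fix j assume "m = \<infinity>" "n = enat j"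
  then show ?thesis using assms[of "Suc j"] by simp
qed simp

text \<open>Two lifts of the same map differ by a continuous integer-valued function, which is
  constant because distinct integers are at distance at least 1. Monotonicity thus passes from the
  lift provided by \<open>orientation_preserving\<close> to the given one.\<close>

lemma lift_strict_mono:
  assumes "orientation_preserving \<alpha>" "is_lift \<alpha> \<gamma>"
  shows "strict_mono \<gamma>"
proof -
  obtain \<gamma>' where \<gamma>': "is_lift \<alpha> \<gamma>'" "strict_mono \<gamma>'"
    using assms(1) by (auto simp: orientation_preserving_def)
  have int: "\<exists>n::int. \<gamma> t = \<gamma>' t + of_int n" for t
    unfolding circ_eq_iff[symmetric] using \<gamma>' assms(2) by (metis is_lift_def)
  have "(\<lambda>t. \<gamma> t - \<gamma>' t) constant_on UNIV"
  proof (rule continuous_discrete_range_constant)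
    show "continuous_on UNIV (\<lambda>t. \<gamma> t - \<gamma>' t)"
      using \<gamma>' assms(2) by (auto simp: is_lift_def intro!: continuous_intros)
    fix s :: real
    have "1 \<le> norm ((\<gamma> t - \<gamma>' t) - (\<gamma> s - \<gamma>' s))" if "\<gamma> t - \<gamma>' t \<noteq> \<gamma> s - \<gamma>' s" for t
    proof -
      obtain m n :: int where "\<gamma> t - \<gamma>' t = of_int m" "\<gamma> s - \<gamma>' s = of_int n"
        using int[of t] int[of s] by auto
      then show ?thesis using that by (simp flip: of_int_diff of_int_abs)
    qed
    then show "\<exists>e>0. \<forall>t. t \<in> UNIV \<and> \<gamma> t - \<gamma>' t \<noteq> \<gamma> s - \<gamma>' s \<longrightarrow> e \<le> norm ((\<gamma> t - \<gamma>' t) - (\<gamma> s - \<gamma>' s))"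
      by (intro exI[of _ 1]) auto
  qed simp
  then obtain k where k: "\<And>t. \<gamma> t - \<gamma>' t = k" by (auto simp: constant_on_def)
  show ?thesis
  proof (rule strict_monoI)
    fix s t :: real assume "s < t"
    then have "\<gamma>' s < \<gamma>' t" using \<gamma>' by (simp add: strict_mono_less)
    then show "\<gamma> s < \<gamma> t" using k[of s] k[of t] by linarith
  qed
qed

text \<open>The increment over a period is an integer, positive by monotonicity. If it were at least
  2, the intermediate value theorem would give a point where \<gamma> has grown by exactly 1,
  against injectivity of \<alpha>.\<close>

lemma lift_shift:
  assumes inj: "inj_on \<alpha> (sphere 0 1)" and lift: "is_lift \<alpha> \<gamma>" and mono: "strict_mono \<gamma>"
  shows "\<gamma> (t + 1) = \<gamma> t + 1"
proof -
  have \<alpha>: "\<alpha> (circ t) = circ (\<gamma> t)" for t using lift by (auto simp: is_lift_def)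
  have "circ (t + 1) = circ t" unfolding circ_eq_iff by (rule exI[of _ 1]) simp
  then have "circ (\<gamma> (t + 1)) = circ (\<gamma> t)" by (metis \<alpha>)
  then obtain n :: int where n: "\<gamma> (t + 1) = \<gamma> t + of_int n" by (auto simp: circ_eq_iff)
  have "\<gamma> t < \<gamma> (t + 1)" using mono by (simp add: strict_mono_less)
  then have "1 \<le> n" using n by simp
  moreover have False if "2 \<le> n"
  proof -
    have "\<exists>s. t \<le> s \<and> s \<le> t + 1 \<and> \<gamma> s = \<gamma> t + 1"
      using lift n that by (intro IVT') (auto simp: is_lift_def intro: continuous_on_subset)
    then obtain s where s: "t \<le> s" "s \<le> t + 1" "\<gamma> s = \<gamma> t + 1" by blast
    have "circ (\<gamma> s) = circ (\<gamma> t)" unfolding circ_eq_iff by (rule exI[of _ 1]) (simp add: s)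
    then have "circ s = circ t" using inj \<alpha> by (metis inj_onD mem_sphere_0 norm_cis)
    then obtain k :: int where k: "s = t + of_int k" by (auto simp: circ_eq_iff)
    then have "0 \<le> k" "k \<le> 1" using s by auto
    \<comment> \<open>At the two ends \<gamma> has grown by 0 and by \<open>n\<close>, and neither
      equals 1.\<close>
    then have "s = t \<or> s = t + 1" using k by (cases "k = 0") (auto simp: not_le)
    then show False using s n that by auto
  qed
  ultimately have "n = 1" by force
  then show ?thesis using n by simp
qed

text \<open>Monotonicity and the translation rule are supplied by the two preceding lemmas when the
  locale is interpreted.\<close>

locale circle_lift =
  fixes \<alpha> :: "complex \<Rightarrow> complex" and \<gamma> :: "real \<Rightarrow> real"
  assumes continuous_map: "continuous_on (sphere 0 1) \<alpha>"
    and lift: "is_lift \<alpha> \<gamma>"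
    and mono: "strict_mono \<gamma>"
    and shift: "\<gamma> (t + 1) = \<gamma> t + 1"
    and pos: "0 < \<gamma> 0"
begin

lemma circ_lift: "\<alpha> (circ t) = circ (\<gamma> t)"
  using lift by (auto simp: is_lift_def)

lemma continuous_lift: "continuous_on S \<gamma>"
  using lift by (auto simp: is_lift_def intro: continuous_on_subset)

lemma lift_le_iff [simp]: "\<gamma> s \<le> \<gamma> t \<longleftrightarrow> s \<le> t"
  using mono by (rule strict_mono_less_eq)

lemma lift_less_iff [simp]: "\<gamma> s < \<gamma> t \<longleftrightarrow> s < t"
  using mono by (rule strict_mono_less)

lemma zero_le_lift: "0 \<le> t \<Longrightarrow> 0 \<le> \<gamma> t"
  using pos lift_le_iff[of 0 t] by linarith

lemma shift_nat: "\<gamma> (t + real n) = \<gamma> t + real n"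
proof (induction n)
  case (Suc n)
  then show ?case using shift[of "t + real n"] by (simp add: algebra_simps)
qed simp

text \<open>The translation rule makes \<gamma> unbounded in both directions, so the intermediate
  value theorem gives surjectivity.\<close>

lemma bij_lift: "bij \<gamma>"
proof -
  have "\<exists>x. \<gamma> x = y" for y
  proof -
    obtain n :: nat where n: "\<bar>y - \<gamma> 0\<bar> \<le> real n" using real_arch_simple by blast
    have "\<exists>x. - real n \<le> x \<and> x \<le> real n \<and> \<gamma> x = y"
      using n shift_nat[of 0 n] shift_nat[of "- real n" n]
      by (intro IVT' continuous_lift) auto
    then show ?thesis by blast
  qed
  then show ?thesis
    using strict_mono_imp_inj_on[OF mono] by (auto simp: bij_def surj_def) metis
qed

definition \<delta> :: "real \<Rightarrow> real"
  where "\<delta> = inv \<gamma>"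

lemma \<gamma>_\<delta> [simp]: "\<gamma> (\<delta> t) = t"
  unfolding \<delta>_def using bij_lift by (simp add: bij_def surj_f_inv_f)

lemma \<delta>_\<gamma> [simp]: "\<delta> (\<gamma> t) = t"
  unfolding \<delta>_def using bij_lift by (simp add: bij_def)

lemma \<delta>_shift: "\<delta> (t + 1) = \<delta> t + 1"
  using \<delta>_\<gamma>[of "\<delta> t + 1"] by (simp add: shift)

lemma le_\<delta>_iff: "s \<le> \<delta> t \<longleftrightarrow> \<gamma> s \<le> t"
  using lift_le_iff[of s "\<delta> t"] by simp

lemma continuous_\<delta>: "continuous_on UNIV \<delta>"
proof -
  obtain g where "homeomorphism UNIV (range \<gamma>) \<gamma> g"
    using injective_into_1d_eq_homeomorphism[OF continuous_lift, of UNIV] bij_lift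
    by (auto simp: bij_def)
  moreover from this have "g = \<delta>"
    using \<gamma>_\<delta> by (metis UNIV_I ext homeomorphism_apply1)
  ultimately show ?thesis
    using bij_lift by (simp add: homeomorphism_def bij_def)
qed

section \<open>The orbit of 0 and the levels of the half-line\<close>

definition orbit :: "nat \<Rightarrow> real"
  where "orbit n = (\<gamma> ^^ n) 0"

lemma orbit_simps [simp]: "orbit 0 = 0" "orbit (Suc n) = \<gamma> (orbit n)"
  by (simp_all add: orbit_def)

lemma orbit_less: "orbit n < \<gamma> (orbit n)"
  by (induction n) (simp_all add: pos)

lemma orbit_strict_mono: "strict_mono orbit"
  by (simp add: strict_mono_Suc_iff orbit_less)

lemma orbit_nonneg: "0 \<le> orbit n"
  using orbit_strict_mono strict_mono_less_eq[of orbit 0 n] by simp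

lemma unit_arc_orbit: "unit_arc \<gamma> n = circ ` {orbit n..orbit (Suc n)}"
  by (simp add: unit_arc_def orbit_def)

text \<open>The step from \<open>orbit n\<close> to \<open>orbit (Suc n)\<close> is at least a full
  turn; this survives applying \<gamma> because \<gamma> is monotone and commutes with translation
  by 1.\<close>

lemma unit_arc_full:
  assumes "1 \<le> \<gamma> 0"
  shows "unit_arc \<gamma> n = sphere 0 1"
proof -
  have "orbit n + 1 \<le> orbit (Suc n)"
  proof (induction n)
    case (Suc n)
    then have "\<gamma> (orbit n + 1) \<le> \<gamma> (orbit (Suc n))" by (simp only: lift_le_iff)
    then show ?case by (simp add: shift)
  qed (use assms in simp)
  then show ?thesis unfolding unit_arc_orbit by (rule circ_image_period)
qed

definition level :: "real \<Rightarrow> enat"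
  where "level t = (if \<forall>n. orbit n \<le> t then \<infinity> else enat (LEAST n. t < orbit (Suc n)))"

text \<open>The working characterization of \<open>level\<close>: thresholds on levels become
  thresholds on times, with the value \<infinity> included.\<close>

lemma le_level_iff:
  assumes "0 \<le> t"
  shows "enat k \<le> level t \<longleftrightarrow> orbit k \<le> t"
proof (cases "\<forall>n. orbit n \<le> t")
  case False
  define m where "m = (LEAST n. t < orbit (Suc n))"
  obtain n where n: "t < orbit n" using False by (auto simp: not_le)
  then have "t < orbit (Suc n)" using orbit_less[of n] by simp
  then have m: "t < orbit (Suc m)" unfolding m_def by (rule LeastI)
  \<comment> \<open>Minimality of \<open>m\<close> gives this for successors; for
    \<open>m = 0\<close> it is the assumption \<open>0 \<le> t\<close>.\<close>
  have le: "orbit m \<le> t"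
  proof (cases m)
    case (Suc j)
    then have "\<not> t < orbit (Suc j)" using not_less_Least[of j "\<lambda>n. t < orbit (Suc n)"] by (simp add: m_def)
    then show ?thesis using Suc by simp
  qed (use assms in simp)
  have "k \<le> m \<longleftrightarrow> orbit k \<le> t"
  proof
    assume "k \<le> m"
    then have "orbit k \<le> orbit m" using orbit_strict_mono by (simp add: strict_mono_less_eq)
    then show "orbit k \<le> t" using le by simp
  next
    assume "orbit k \<le> t"
    then have "orbit k < orbit (Suc m)" using m by simp
    then show "k \<le> m" using orbit_strict_mono by (metis less_Suc_eq_le strict_mono_less)
  qed
  then show ?thesis using False by (simp add: level_def m_def)
qed (simp add: level_def)

lemma level_eq_enat_iff:
  assumes "0 \<le> t"
  shows "level t = enat k \<longleftrightarrow> orbit k \<le> t \<and> t < orbit (Suc k)"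
  using le_level_iff[OF assms, of k] le_level_iff[OF assms, of "Suc k"]
  by (cases "level t") auto

lemma level_eq_infinity_iff:
  assumes "0 \<le> t"
  shows "level t = \<infinity> \<longleftrightarrow> (\<forall>k. orbit k \<le> t)"
proof (cases "level t")
  case (enat m)
  then have "\<not> enat (Suc m) \<le> level t" by simp
  then have "\<not> orbit (Suc m) \<le> t" using le_level_iff[OF assms] by blast
  then show ?thesis using enat by (metis enat.distinct(1))
next
  case infinity
  then show ?thesis using le_level_iff[OF assms] by simp
qed

text \<open>Since \<gamma> is increasing, \<open>orbit (Suc j) \<le> \<gamma> t\<close> is
  equivalent to \<open>orbit j \<le> t\<close>, so each threshold moves up by one.\<close>

lemma level_lift:
  assumes "0 \<le> t"
  shows "level (\<gamma> t) = eSuc (level t)"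
proof -
  have "0 \<le> \<gamma> t" using assms by (rule zero_le_lift)
  have "enat k \<le> level (\<gamma> t) \<longleftrightarrow> enat k \<le> eSuc (level t)" for k
  proof (cases k)
    case (Suc j)
    then show ?thesis
      using le_level_iff[OF assms, of j] le_level_iff[OF \<open>0 \<le> \<gamma> t\<close>, of k]
      by (simp flip: eSuc_enat)
  qed (simp add: zero_enat_def[symmetric])
  then show ?thesis by (rule enat_eqI)
qed

section \<open>The model space, its projection and its self-map\<close>

text \<open>One description for both cases: when \<open>1 \<le> \<gamma> 0\<close>, every arc is the
  whole circle.\<close>

definition model :: "(enat \<times> complex) set"
  where "model = {(n, z). z \<in> sphere 0 1 \<and> (\<forall>N. n = enat N \<longrightarrow> z \<in> unit_arc \<gamma> N)}"

definition proj :: "real \<Rightarrow> enat \<times> complex"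
  where "proj t = (level t, circ t)"

lemma proj_in_model: "0 \<le> t \<Longrightarrow> proj t \<in> model"
  by (auto simp: model_def proj_def level_eq_enat_iff unit_arc_orbit)

lemma model_map_eq: "model_map \<alpha> (n, z) = (eSuc n, \<alpha> z)"
  by (cases n) (auto simp: model_map_def eSuc_enat)

lemma proj_lift: "0 \<le> t \<Longrightarrow> proj (\<gamma> t) = model_map \<alpha> (proj t)"
  by (simp add: proj_def model_map_eq level_lift circ_lift)

lemma model_map_in_model:
  assumes "q \<in> model"
  shows "model_map \<alpha> q \<in> model"
proof -
  obtain n z where q: "q = (n, z)" by (cases q)
  have z: "z \<in> sphere 0 1" using assms q by (simp add: model_def)
  then obtain t where "z = circ t" by (rule circ_surj)
  then have "\<alpha> z \<in> sphere 0 1" by (simp add: circ_lift)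
  moreover have "\<alpha> z \<in> unit_arc \<gamma> N" if N: "eSuc n = enat N" for N
  proof -
    obtain k where k: "n = enat k" "N = Suc k" using N by (cases n) (auto simp: eSuc_enat)
    then have "z \<in> circ ` {orbit k..orbit (Suc k)}"
      using assms q by (simp add: model_def unit_arc_orbit)
    then obtain s where "z = circ s" "orbit k \<le> s" "s \<le> orbit (Suc k)" by auto
    then show ?thesis by (auto simp: k unit_arc_orbit circ_lift)
  qed
  ultimately show ?thesis by (simp add: q model_map_eq model_def)
qed

text \<open>Finite levels are isolated in \<open>enat\<close>, so restricting a single level to its
  closed arc is a closed condition inside the compact product of \<open>enat\<close> and the
  circle.\<close>

lemma compact_model: "compact model"
proof -
  have "model = (UNIV \<times> sphere 0 1) \<inter> (\<Inter>N. (- {enat N}) \<times> UNIV \<union> UNIV \<times> unit_arc \<gamma> N)"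
    by (auto simp: model_def)
  moreover have "compact (UNIV \<times> sphere 0 1 :: (enat \<times> complex) set)"
    by (intro compact_Times compact_UNIV compact_sphere)
  moreover have "closed (- {enat N})" for N
    by (intro closed_Compl) (auto simp: open_enat_iff_cofinite)
  moreover have "closed (unit_arc \<gamma> N)" for N
    unfolding unit_arc_orbit
    by (intro compact_imp_closed compact_continuous_image continuous_intros compact_Icc)
  ultimately show ?thesis
    by (auto intro!: compact_Int_closed closed_INT closed_Un closed_Times)
qed

lemma continuous_model_map: "continuous_on model (model_map \<alpha>)"
proof -
  \<comment> \<open>Injectivity of \<open>eSuc\<close> keeps complements finite under
    preimages.\<close>
  have "open (eSuc -` S)" if "open S" for S
  proof -
    have "- (eSuc -` S) = eSuc -` (- S)" by auto
    then show ?thesis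
      using that finite_vimageI[of "- S" eSuc] by (auto simp: open_enat_iff_cofinite inj_on_def)
  qed
  then have eSuc: "continuous_on UNIV eSuc"
    by (simp add: continuous_on_open_vimage)
  have "continuous_on model (\<lambda>q. (eSuc (fst q), \<alpha> (snd q)))"
    by (intro continuous_on_Pair continuous_on_compose2[OF eSuc] continuous_on_compose2[OF continuous_map]
        continuous_intros) (auto simp: model_def)
  then show ?thesis
    by (rule continuous_on_eq) (auto simp: model_map_eq)
qed

end

context circle_lift
begin

text \<open>The levels from \<open>n\<close> on form an open and closed subset of
  \<open>enat\<close>. These are the symbols that the generators turn out to have.\<close>

lemma continuous_on_model_step:
  assumes "continuous_on (sphere 0 1) b"
  shows "continuous_on model (\<lambda>(m, z). if enat n \<le> m then b z else 0 :: complex)"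
proof -
  have "open {m. enat n \<le> m}"
    unfolding open_enat_iff_cofinite
    using finite_enat_bounded[of "- {m. enat n \<le> m}" n] by (auto simp: not_le)
  moreover have "open {m. m < enat n}" using open_lessThan[of "enat n"] by (simp add: lessThan_def)
  moreover have "(\<lambda>m. if enat n \<le> m then 1 else 0 :: complex) -` B =
      (if 1 \<in> B then {m. enat n \<le> m} else {}) \<union> (if 0 \<in> B then {m. m < enat n} else {})" for B
    by (auto split: if_splits)
  ultimately have step: "continuous_on UNIV (\<lambda>m. if enat n \<le> m then 1 else 0 :: complex)"
    by (auto simp: continuous_on_open_vimage intro!: open_Un)
  have "continuous_on model (\<lambda>q. (if enat n \<le> fst q then 1 else 0) * b (snd q))"
    by (intro continuous_on_mult continuous_on_compose2[OF step] continuous_on_compose2[OF assms]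
        continuous_intros) (auto simp: model_def)
  then show ?thesis
    by (rule continuous_on_eq) auto
qed

sublocale compact_model model proj
proof
  show "compact model" by (rule compact_model)
  show "proj t \<in> model" if "0 \<le> t" for t using that by (rule proj_in_model)
next
  fix c :: "enat \<times> complex \<Rightarrow> complex" assume c: "continuous_on model c"
  \<comment> \<open>Countably many Borel level sets cover the half-line; on each the first
    coordinate of \<open>proj\<close> is constant, so the pullback is continuous there.\<close>
  define L where "L n = {t. 0 \<le> t \<and> level t = n}" for n
  have L: "L n \<in> sets borel" for n
  proof (cases n)
    case (enat k)
    have "L n = {orbit k..<orbit (Suc k)}"
      using orbit_nonneg[of k] by (auto simp: L_def enat level_eq_enat_iff)
    then show ?thesis by simp
  next
    case infinity
    have "L n = (\<Inter>k. {orbit k..})"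
      using order_trans[OF orbit_nonneg] by (auto simp: L_def infinity level_eq_infinity_iff)
    then show ?thesis by auto
  qed
  show "pullback proj c \<in> borel_measurable borel"
  proof (rule measurable_piecewise_restrict)
    show "countable (insert {..<0} (range L))" by simp
    show "\<Omega> \<inter> space borel \<in> sets borel" if "\<Omega> \<in> insert {..<0} (range L)" for \<Omega>
      using that L by auto
    show "space borel \<subseteq> \<Union> (insert {..<0} (range L))" by (auto simp: L_def)
    fix \<Omega> assume "\<Omega> \<in> insert {..<0} (range L)"
    then show "pullback proj c \<in> borel_measurable (restrict_space borel \<Omega>)"
    proof
      assume "\<Omega> = {..<0}"
      then show ?thesis
        by (intro borel_measurable_continuous_on_restrict continuous_on_eq[OF continuous_on_const[of _ 0]])
          (auto simp: pullback_def)
    next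
      assume "\<Omega> \<in> range L"
      then obtain n where \<Omega>: "\<Omega> = L n" by blast
      have "continuous_on (L n) (\<lambda>t. c (n, circ t))"
        using proj_in_model
        by (intro continuous_on_compose2[OF c] continuous_intros) (auto simp: L_def proj_def)
      then have "continuous_on (L n) (pullback proj c)"
        by (rule continuous_on_eq) (auto simp: L_def pullback_def proj_def)
      then show ?thesis unfolding \<Omega> by (rule borel_measurable_continuous_on_restrict)
    qed
  qed
next
  fix V :: "(enat \<times> complex) set" assume V: "open V" "V \<inter> model \<noteq> {}"
  then obtain n z where nz: "(n, z) \<in> V" "(n, z) \<in> model" by auto
  obtain A B where AB: "open A" "open B" "n \<in> A" "z \<in> B" "A \<times> B \<subseteq> V"
    using open_prod_elim[OF V(1) nz(1)] by (metis mem_Sigma_iff)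
  define W where "W = circ -` B"
  have W: "open W"
    unfolding W_def by (rule open_vimage[OF AB(2)]) (intro continuous_intros)
  show "\<exists>A. open A \<and> A \<noteq> {} \<and> A \<subseteq> {0..} \<and> proj ` A \<subseteq> V"
  proof (cases n)
    case (enat N)
    let ?I = "{orbit N<..<orbit (Suc N)}"
    obtain s where s: "z = circ s" "s \<in> {orbit N..orbit (Suc N)}"
      using nz by (auto simp: model_def enat unit_arc_orbit)
    \<comment> \<open>The point \<open>s\<close> may be an end of the arc, and the right end has
      level \<open>Suc N\<close> instead of \<open>N\<close>. Being in the closure of the open
      interval, it still has nearby points of level \<open>N\<close>.\<close>
    have "s \<in> W \<inter> closure ?I"
      using s AB orbit_less[of N] by (simp add: W_def closure_greaterThanLessThan)
    then have "W \<inter> ?I \<noteq> {}" using open_Int_closure_eq_empty[OF W] by blast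
    moreover have "proj t \<in> V" if t: "t \<in> W \<inter> ?I" for t
    proof -
      have "level t = n"
        using t orbit_nonneg[of N] by (subst enat, subst level_eq_enat_iff) auto
      then show ?thesis using t AB by (auto simp: proj_def W_def)
    qed
    moreover have "W \<inter> ?I \<subseteq> {0..}" using orbit_nonneg[of N] by auto
    ultimately show ?thesis
      using W by (intro exI[of _ "W \<inter> ?I"]) auto
  next
    case infinity
    then obtain K where K: "{enat K<..} \<subseteq> A" using AB by (auto simp: open_enat_iff)
    \<comment> \<open>Times beyond \<open>orbit (Suc K)\<close> have level greater than
      \<open>K\<close>. A large integer translate of \<open>s\<close> lies there and has the same
      image on the circle.\<close>
    let ?I = "{orbit (Suc K)<..}"
    obtain s where s: "z = circ s" using nz circ_surj[of z] by (auto simp: model_def)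
    obtain m :: nat where m: "orbit (Suc K) - s < real m" using reals_Archimedean2 by blast
    have "circ (s + of_int (int m)) = circ s" unfolding circ_eq_iff by blast
    then have "s + of_int (int m) \<in> W" using AB s by (simp add: W_def)
    then have "s + of_int (int m) \<in> W \<inter> ?I" using m by auto
    moreover have "proj t \<in> V" if t: "t \<in> W \<inter> ?I" for t
    proof -
      have "0 \<le> t" using t orbit_nonneg[of "Suc K"] by auto
      then have "enat (Suc K) \<le> level t" using t le_level_iff[of t "Suc K"] by auto
      then have "enat K < level t" by (simp add: Suc_ile_eq)
      then show ?thesis using t AB K by (auto simp: proj_def W_def)
    qed
    moreover have "W \<inter> ?I \<subseteq> {0..}" using orbit_nonneg[of "Suc K"] by auto
    ultimately show ?thesis
      using W by (intro exI[of _ "W \<inter> ?I"]) auto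
  qed
qed

end

section \<open>The compressed weighted shift\<close>

lemma blinfun_compose_assoc: "(R o\<^sub>L S) o\<^sub>L T = R o\<^sub>L (S o\<^sub>L T)"
  by (rule blinfun_eqI) simp

lemma blinfun_compose_id [simp]: "id_blinfun o\<^sub>L T = T" "T o\<^sub>L id_blinfun = T"
  by (auto intro: blinfun_eqI)

text \<open>The weight \<open>w\<close> stays abstract: it cancels in conjugations of multiplication
  operators, and the isometry property is contained in \<open>is_unitary\<close>.\<close>

locale weighted_composition = circle_lift +
  fixes UU :: "L2 \<Rightarrow>\<^sub>L L2" and w :: "real \<Rightarrow> complex"
  assumes unitary: "is_unitary UU"
    and composition: "f \<in> sq_integrable \<Longrightarrow>
      AE t in lborel. L2_rep (UU (L2_class f)) t = w t * f (\<gamma> t)"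
begin

lemma measurable_lift [measurable]: "\<gamma> \<in> borel_measurable borel" "\<delta> \<in> borel_measurable borel"
  by (auto intro: borel_measurable_continuous_onI continuous_lift continuous_\<delta>)

text \<open>Multiplication before the composition becomes multiplication by
  \<open>f \<circ> \<gamma>\<close> after it, the weight being a common factor.\<close>

lemma UU_mult_op:
  assumes f: "bounded_borel f"
  shows "UU o\<^sub>L mult_op f = mult_op (\<lambda>t. f (\<gamma> t)) o\<^sub>L UU"
proof (rule blinfun_eqI, rule L2_eqI)
  fix F
  have f\<gamma>: "bounded_borel (\<lambda>t. f (\<gamma> t))" using f by (rule bounded_borel_comp) simp
  have "AE t in lborel. L2_rep (UU F) t = w t * L2_rep F (\<gamma> t)"
    using composition[OF L2_rep_in[of F]] by simp
  \<comment> \<open>\<open>composition\<close> is applied to the explicit representative given by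
    \<open>mult_op_class\<close>. Substituting \<gamma> into an almost everywhere identity would
    instead require that preimages of null sets under \<gamma> be null.\<close>
  moreover have "AE t in lborel. L2_rep (UU (mult_op f F)) t = w t * (f (\<gamma> t) * L2_rep F (\<gamma> t))"
    unfolding mult_op_class[OF f] by (rule composition[OF bounded_borel_sq[OF f L2_rep_in]])
  ultimately show "AE t in lborel. L2_rep ((UU o\<^sub>L mult_op f) F) t =
      L2_rep ((mult_op (\<lambda>t. f (\<gamma> t)) o\<^sub>L UU) F) t"
    using mult_op_rep'[OF f\<gamma>, of "UU F"]
    by eventually_elim (simp add: mult_ac)
qed

text \<open>The adjoint of the unitary, obtained as its inverse, so that no formula with the
  derivative of the inverse lift is involved; \<open>cinner_UU\<close> confirms the adjoint
  relation.\<close>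

definition UUinv :: "L2 \<Rightarrow>\<^sub>L L2"
  where "UUinv = Blinfun (inv (blinfun_apply UU))"

lemma norm_UU: "norm (UU F) = norm F"
  using unitary by (simp add: is_unitary_def norm_L2_def inner_L2_def)

lemma bij_UU: "bij (blinfun_apply UU)"
proof -
  have "inj (blinfun_apply UU)"
  proof (rule injI)
    fix F G assume "UU F = UU G"
    then have "norm (UU (F - G)) = 0" by (simp add: blinfun.diff_right)
    then show "F = G" by (simp add: norm_UU)
  qed
  then show ?thesis using unitary by (simp add: is_unitary_def bij_def)
qed

lemma UUinv_apply: "blinfun_apply UUinv = inv (blinfun_apply UU)"
  unfolding UUinv_def
proof (rule bounded_linear_Blinfun_apply, rule bounded_linear_intro[where K = 1])
  have [simp]: "UU (inv (blinfun_apply UU) F) = F" for F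
    using bij_UU by (simp add: bij_def surj_f_inv_f)
  have eq: "F = G" if "UU F = UU G" for F G using bij_UU that by (auto simp: bij_def inj_def)
  fix F G and r :: real
  show "inv (blinfun_apply UU) (F + G) = inv (blinfun_apply UU) F + inv (blinfun_apply UU) G"
    by (rule eq) (simp add: blinfun.add_right)
  show "inv (blinfun_apply UU) (r *\<^sub>R F) = r *\<^sub>R inv (blinfun_apply UU) F"
    by (rule eq) (simp add: blinfun.scaleR_right)
  show "norm (inv (blinfun_apply UU) F) \<le> norm F * 1"
    using norm_UU[of "inv (blinfun_apply UU) F"] by simp
qed

lemma UU_UUinv: "UU o\<^sub>L UUinv = id_blinfun" "UUinv o\<^sub>L UU = id_blinfun"
  using bij_UU by (auto intro!: blinfun_eqI simp: UUinv_apply bij_def surj_f_inv_f)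

lemma cinner_UU: "cinner (UU F) G = cinner F (UUinv G)"
proof -
  have "cinner (UU F) (UU (UUinv G)) = cinner F (UUinv G)"
    using unitary by (simp add: is_unitary_def)
  moreover have "UU (UUinv G) = G"
    using UU_UUinv(1) by (metis blinfun_apply_blinfun_compose blinfun_apply_id_blinfun id_apply)
  ultimately show ?thesis by simp
qed

text \<open>Both formulas come from \<open>UU_mult_op\<close>, the second by applying it to
  \<open>f \<circ> \<delta>\<close>.\<close>

lemma conjugate_mult_op:
  assumes f: "bounded_borel f"
  shows "UU o\<^sub>L mult_op f o\<^sub>L UUinv = mult_op (\<lambda>t. f (\<gamma> t))"
    and "UUinv o\<^sub>L mult_op f o\<^sub>L UU = mult_op (\<lambda>t. f (\<delta> t))"
proof -
  have f\<delta>: "bounded_borel (\<lambda>t. f (\<delta> t))" using f by (rule bounded_borel_comp) simp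
  show "UU o\<^sub>L mult_op f o\<^sub>L UUinv = mult_op (\<lambda>t. f (\<gamma> t))"
    by (simp add: UU_mult_op[OF f] blinfun_compose_assoc UU_UUinv)
  have "UU o\<^sub>L mult_op (\<lambda>t. f (\<delta> t)) = mult_op f o\<^sub>L UU"
    by (simp add: UU_mult_op[OF f\<delta>])
  then have "UUinv o\<^sub>L mult_op f o\<^sub>L UU = (UUinv o\<^sub>L UU) o\<^sub>L mult_op (\<lambda>t. f (\<delta> t))"
    by (simp add: blinfun_compose_assoc)
  then show "UUinv o\<^sub>L mult_op f o\<^sub>L UU = mult_op (\<lambda>t. f (\<delta> t))"
    by (simp add: UU_UUinv)
qed

section \<open>Compression to the half-line and conjugation by \<open>U\<close>\<close>

abbreviation half :: "real \<Rightarrow> complex"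
  where "half \<equiv> indicator {0..}"

lemma bounded_borel_half [simp]: "bounded_borel half"
  by (rule bounded_borel_indicator) simp

definition U :: "L2 \<Rightarrow>\<^sub>L L2"
  where "U = compression UU"

text \<open>Since \<open>\<gamma>\<close> maps the half-line into itself, the right-hand projection is redundant.\<close>

lemma U_eq: "U = mult_op half o\<^sub>L UU"
proof -
  have "bounded_borel (\<lambda>t. half (\<gamma> t))" by (rule bounded_borel_comp) auto
  then have "U = mult_op (\<lambda>t. half t * half (\<gamma> t)) o\<^sub>L UU"
    unfolding U_def compression_def proj_H_eq
    by (simp add: blinfun_compose_assoc UU_mult_op) (simp add: blinfun_compose_assoc[symmetric] mult_op_comp)
  moreover have "half t * half (\<gamma> t) = half t" for t
    using zero_le_lift[of t] by (auto simp: indicator_def)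
  ultimately show ?thesis by simp
qed

lemma adj_U: "adj U = UUinv o\<^sub>L mult_op half"
proof (rule adj_eqI)
  fix F G
  have "(\<lambda>t. cnj (half t)) = half" by (auto simp: indicator_def)
  then show "cinner (U F) G = cinner F ((UUinv o\<^sub>L mult_op half) G)"
    using cinner_mult_op[OF bounded_borel_half, of "UU F" G] by (simp add: U_eq cinner_UU)
qed

lemma U_conjugate:
  assumes f: "bounded_borel f"
  shows "U o\<^sub>L mult_op f o\<^sub>L adj U = mult_op (\<lambda>t. half t * f (\<gamma> t))"
    and "adj U o\<^sub>L mult_op f o\<^sub>L U = mult_op (\<lambda>t. half (\<delta> t) * f (\<delta> t))"
proof -
  have f\<gamma>: "bounded_borel (\<lambda>t. f (\<gamma> t))" using f by (rule bounded_borel_comp) simp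
  have "U o\<^sub>L mult_op f o\<^sub>L adj U = mult_op half o\<^sub>L (UU o\<^sub>L mult_op f o\<^sub>L UUinv) o\<^sub>L mult_op half"
    unfolding adj_U by (simp add: U_eq blinfun_compose_assoc)
  also have "\<dots> = mult_op (\<lambda>t. half t * f (\<gamma> t) * half t)"
    by (simp add: conjugate_mult_op f f\<gamma> mult_op_comp bounded_borel_mult)
  also have "(\<lambda>t. half t * f (\<gamma> t) * half t) = (\<lambda>t. half t * f (\<gamma> t))"
    by (auto simp: indicator_def)
  finally show "U o\<^sub>L mult_op f o\<^sub>L adj U = mult_op (\<lambda>t. half t * f (\<gamma> t))" .
  have "adj U o\<^sub>L mult_op f o\<^sub>L U = UUinv o\<^sub>L (mult_op half o\<^sub>L (mult_op f o\<^sub>L mult_op half)) o\<^sub>L UU"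
    unfolding adj_U by (simp add: U_eq blinfun_compose_assoc)
  also have "mult_op half o\<^sub>L (mult_op f o\<^sub>L mult_op half) = mult_op (\<lambda>t. half t * (f t * half t))"
    by (simp add: f mult_op_comp bounded_borel_mult)
  also have "(\<lambda>t. half t * (f t * half t)) = (\<lambda>t. half t * f t)"
    by (auto simp: indicator_def)
  also have "UUinv o\<^sub>L mult_op (\<lambda>t. half t * f t) o\<^sub>L UU = mult_op (\<lambda>t. half (\<delta> t) * f (\<delta> t))"
    by (rule conjugate_mult_op) (intro bounded_borel_mult bounded_borel_half f)
  finally show "adj U o\<^sub>L mult_op f o\<^sub>L U = mult_op (\<lambda>t. half (\<delta> t) * f (\<delta> t))" .
qed

text \<open>Both forms are required: the induction on generators splits the outermost
  \<open>adj U\<close> off on the left but \<open>U\<close> off on the right, leaving the previous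
  generator in the middle.\<close>

lemma op_power_Suc: "op_power T (Suc n) = T o\<^sub>L op_power T n" "op_power T (Suc n) = op_power T n o\<^sub>L T"
proof -
  show *: "op_power T (Suc n) = T o\<^sub>L op_power T n" for n by (simp add: op_power_def)
  show "op_power T (Suc n) = op_power T n o\<^sub>L T"
  proof (induction n)
    case (Suc n)
    have "op_power T (Suc (Suc n)) = T o\<^sub>L (op_power T n o\<^sub>L T)" by (simp only: * Suc.IH[symmetric])
    then show ?case by (simp only: * blinfun_compose_assoc)
  qed (simp add: op_power_def)
qed

text \<open>Each further conjugation by \<open>adj U\<close> composes the symbol with \<delta>,
  which moves the edge of its support from \<open>orbit n\<close> to
  \<open>orbit (Suc n)\<close>.\<close>

lemma generator_eq:
  assumes a: "bounded_borel a"
  shows "op_power (adj U) n o\<^sub>L compression (mult_op a) o\<^sub>L op_power U n =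
    mult_op (\<lambda>t. indicator {orbit n..} t * a ((\<delta> ^^ n) t))"
proof (induction n)
  case 0
  have "compression (mult_op a) = mult_op (\<lambda>t. half t * a t * half t)"
    unfolding compression_def proj_H_eq by (simp add: a mult_op_comp bounded_borel_mult)
  also have "(\<lambda>t. half t * a t * half t) = (\<lambda>t. half t * a t)"
    by (auto simp: indicator_def)
  finally show ?case by (simp add: op_power_def)
next
  case (Suc n)
  have "(\<delta> ^^ n) \<in> borel_measurable borel" for n
    by (induction n) (auto intro: measurable_compose simp: id_def)
  then have bb: "bounded_borel (\<lambda>t. indicator {orbit n..} t * a ((\<delta> ^^ n) t))"
    by (intro bounded_borel_mult bounded_borel_indicator bounded_borel_comp[OF a]) auto
  have "op_power (adj U) (Suc n) o\<^sub>L compression (mult_op a) o\<^sub>L op_power U (Suc n) =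
      adj U o\<^sub>L (op_power (adj U) n o\<^sub>L compression (mult_op a) o\<^sub>L op_power U n) o\<^sub>L U"
    unfolding op_power_Suc(1)[of "adj U"] op_power_Suc(2)[of U]
    by (simp only: blinfun_compose_assoc)
  also have "\<dots> = mult_op (\<lambda>t. half (\<delta> t) * (indicator {orbit n..} (\<delta> t) * a ((\<delta> ^^ n) (\<delta> t))))"
    unfolding Suc.IH by (rule U_conjugate(2)[OF bb])
  also have "(\<lambda>t. half (\<delta> t) * (indicator {orbit n..} (\<delta> t) * a ((\<delta> ^^ n) (\<delta> t)))) =
      (\<lambda>t. indicator {orbit (Suc n)..} t * a ((\<delta> ^^ Suc n) t))"
    \<comment> \<open>From \<open>orbit n \<le> \<delta> t\<close> follows
      \<open>0 \<le> \<delta> t\<close>, so the indicator of the half-line is absorbed.\<close>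
    using order_trans[OF orbit_nonneg, of n]
    by (auto simp: indicator_def le_\<delta>_iff[of "orbit n", symmetric] funpow_swap1)
  finally show ?case .
qed

definition generators :: "(L2 \<Rightarrow>\<^sub>L L2) set"
  where "generators = (\<Union>n. {op_power (adj U) n o\<^sub>L T o\<^sub>L op_power U n | T. T \<in> alg_A})"

lemma generatorsI: "T \<in> alg_A \<Longrightarrow> op_power (adj U) n o\<^sub>L T o\<^sub>L op_power U n \<in> generators"
  unfolding generators_def by blast

text \<open>The support condition \<open>orbit n \<le> t\<close> is
  \<open>enat n \<le> level t\<close>, so the symbol in \<open>generator_eq\<close> factors through
  \<open>proj\<close>.\<close>

lemma generator_model_op:
  assumes a: "continuous_on UNIV a" "\<And>t. a (t + 1) = a t"
    and b: "\<And>t. b (circ t) = a ((\<delta> ^^ n) t)"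
  shows "op_power (adj U) n o\<^sub>L compression (mult_op a) o\<^sub>L op_power U n =
    model_op proj (\<lambda>(m, z). if enat n \<le> m then b z else 0)"
proof -
  \<comment> \<open>Passing to the compact circle shows that the periodic function \<open>a\<close>
    is bounded.\<close>
  obtain b0 where b0: "continuous_on (sphere 0 1) b0" "\<And>t. b0 (circ t) = a t"
    using periodic_factors_through_circle[OF a] by blast
  have "bounded (b0 ` sphere 0 1)"
    by (intro compact_imp_bounded compact_continuous_image b0 compact_sphere)
  then obtain K where "\<forall>z\<in>sphere 0 1. cmod (b0 z) \<le> K" unfolding bounded_iff by blast
  then have "cmod (a t) \<le> K" for t using b0(2)[of t] by (metis mem_sphere_0 norm_cis)
  then have "bounded_borel a" using a by (intro bounded_borelI borel_measurable_continuous_onI)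
  moreover have "indicator {orbit n..} t * a ((\<delta> ^^ n) t) =
      pullback proj (\<lambda>(m, z). if enat n \<le> m then b z else 0) t" for t
    using orbit_nonneg[of n] by (auto simp: pullback_def proj_def le_level_iff b)
  ultimately show ?thesis by (simp add: generator_eq model_op_def)
qed

text \<open>The iterates of \<delta> commute with translation by 1, so
  \<open>a \<circ> \<delta>^n\<close> is again periodic and descends to a continuous function on the
  circle.\<close>

lemma generators_in_model_algebra: "generators \<subseteq> model_algebra"
proof
  fix T assume "T \<in> generators"
  then obtain n a where a: "continuous_on UNIV a" "\<And>t. a (t + 1) = a t"
    and T: "T = op_power (adj U) n o\<^sub>L compression (mult_op a) o\<^sub>L op_power U n"
    by (auto simp: generators_def alg_A_def)
  have "continuous_on UNIV (\<delta> ^^ n)"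
    by (induction n) (auto intro: continuous_on_compose2[OF continuous_\<delta>] simp: id_def comp_def)
  then have "continuous_on UNIV (\<lambda>t. a ((\<delta> ^^ n) t))" by (intro continuous_on_compose2[OF a(1)]) auto
  moreover have "(\<delta> ^^ n) (t + 1) = (\<delta> ^^ n) t + 1" for t
    by (induction n) (simp_all add: \<delta>_shift)
  ultimately obtain b where "continuous_on (sphere 0 1) b" "\<And>t. b (circ t) = a ((\<delta> ^^ n) t)"
    using periodic_factors_through_circle[of "\<lambda>t. a ((\<delta> ^^ n) t)"] a(2) by metis
  then show "T \<in> model_algebra"
    unfolding T model_algebra_def
    using continuous_on_model_step generator_model_op[OF a] by blast
qed

lemma step_in_generators: "model_op proj (\<lambda>(m, z). if enat n \<le> m then 1 else 0) \<in> generators"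
proof -
  have "op_power (adj U) n o\<^sub>L compression (mult_op (\<lambda>_. 1)) o\<^sub>L op_power U n =
      model_op proj (\<lambda>(m, z). if enat n \<le> m then 1 else 0)"
    by (rule generator_model_op) auto
  moreover have "compression (mult_op (\<lambda>_. 1)) \<in> alg_A"
    by (auto simp: alg_A_def intro!: exI[of _ "\<lambda>_. 1"])
  ultimately show ?thesis using generatorsI by metis
qed

lemma circle_function_in_generators:
  assumes "continuous_on (sphere 0 1) b"
  shows "model_op proj (\<lambda>(m, z). b z) \<in> generators"
proof -
  let ?a = "\<lambda>t. b (circ t)"
  have c: "continuous_on UNIV ?a"
    by (intro continuous_on_compose2[OF assms] continuous_intros) auto
  have per: "?a (t + 1) = ?a t" for t
    by (rule arg_cong[where f = b]) (unfold circ_eq_iff, rule exI[of _ 1], simp)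
  have "op_power (adj U) 0 o\<^sub>L compression (mult_op ?a) o\<^sub>L op_power U 0 =
      model_op proj (\<lambda>(m, z). if enat 0 \<le> m then b z else 0)"
    using c per by (rule generator_model_op) simp
  moreover have "(\<lambda>(m, z). if enat 0 \<le> m then b z else 0) = (\<lambda>(m, z). b z)"
    by (simp add: zero_enat_def[symmetric])
  moreover have "compression (mult_op ?a) \<in> alg_A"
    using c per by (auto simp: alg_A_def)
  ultimately show ?thesis using generatorsI by metis
qed

text \<open>Points on different levels are separated by a step generator from \<open>a = 1\<close>;
  points over different places of the circle by a coordinate function, a generator with
  \<open>n = 0\<close>.\<close>

lemma model_separating:
  assumes "q \<in> model" "r \<in> model" "q \<noteq> r"
  shows "\<exists>g :: enat \<times> complex \<Rightarrow> real. continuous_on model g \<and>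
    model_op proj (\<lambda>q. of_real (g q)) \<in> generators \<and> g q \<noteq> g r"
proof (cases "snd q = snd r")
  case True
  then have "fst q \<noteq> fst r" using assms by (simp add: prod_eq_iff)
  then obtain n where n: "\<not> (enat n \<le> fst q \<longleftrightarrow> enat n \<le> fst r)" using enat_eqI by blast
  \<comment> \<open>Taking \<open>Re\<close> gives the step function the real type that
    Stone-Weierstrass asks for.\<close>
  define g :: "enat \<times> complex \<Rightarrow> real" where "g q = Re (case q of (m, z) \<Rightarrow> if enat n \<le> m then 1 else 0)" for q
  have "continuous_on model g"
    unfolding g_def by (intro continuous_intros continuous_on_model_step)
  moreover have "(\<lambda>q. complex_of_real (g q)) = (\<lambda>(m, z). if enat n \<le> m then 1 else 0)"
    by (auto simp: g_def)
  ultimately show ?thesis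
    using n step_in_generators[of n] by (intro exI[of _ g]) (auto simp: g_def split: prod.splits)
next
  case False
  then obtain h where h: "h = Re \<or> h = Im" "h (snd q) \<noteq> h (snd r)" by (auto simp: complex_eq_iff)
  then have "continuous_on S h" for S
    by (auto intro!: continuous_intros)
  moreover from this have "continuous_on model (\<lambda>q. h (snd q))"
    by (rule continuous_on_compose2[where t = UNIV]) (auto intro!: continuous_intros)
  moreover have "model_op proj (\<lambda>q. complex_of_real (h (snd q))) \<in> generators"
    using circle_function_in_generators[of "\<lambda>z. complex_of_real (h z)"] \<open>\<And>S. continuous_on S h\<close>
    by (simp add: case_prod_unfold continuous_on_of_real)
  ultimately show ?thesis
    using h by (intro exI[of _ "\<lambda>q. h (snd q)"]) simp
qed

lemma alg_B_eq: "alg_B U = model_algebra"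
proof -
  have "model_op proj (\<lambda>_. 1) \<in> generators"
    using circle_function_in_generators[of "\<lambda>_. 1"] by (simp add: case_prod_unfold)
  then have "cstar_generated generators = model_algebra"
    by (rule cstar_generated_model[OF generators_in_model_algebra]) (rule model_separating)
  then show ?thesis by (simp add: alg_B_def generators_def)
qed

lemma spectrum_alg_B: "homeomorphic_map (top_of_set model) (spectrum (alg_B U)) point_character"
  unfolding alg_B_eq
proof (rule spectrum_model_algebra)
  fix q r assume "q \<in> model" "r \<in> model" "q \<noteq> r"
  then obtain g :: "enat \<times> complex \<Rightarrow> real" where "continuous_on model g" "g q \<noteq> g r"
    using model_separating by blast
  then show "\<exists>c :: enat \<times> complex \<Rightarrow> complex. continuous_on model c \<and> c q \<noteq> c r"
    by (intro exI[of _ "\<lambda>q. of_real (g q)"]) (auto intro!: continuous_intros)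
qed

text \<open>Conjugation by \<open>U\<close> composes the symbol with \<gamma> on times, which by
  \<open>proj_lift\<close> is composition with \<open>model_map \<alpha>\<close> on the model.
  Evaluating at \<open>q\<close> is then evaluating the original symbol at the image of
  \<open>q\<close>.\<close>

lemma generated_map_point_character:
  assumes q: "q \<in> model"
  shows "generated_map U (alg_B U) (point_character q) = point_character (model_map \<alpha> q)"
  unfolding generated_map_def alg_B_eq
proof (rule extensionalityI[where A = model_algebra])
  show "point_character (model_map \<alpha> q) \<in> extensional model_algebra"
    by (simp add: point_character_def)
  fix T assume "T \<in> model_algebra"
  then obtain c where c: "continuous_on model c" "T = model_op proj c"
    by (auto simp: model_algebra_def)
  have c': "continuous_on model (\<lambda>q. c (model_map \<alpha> q))"
    by (rule continuous_on_compose2[OF c(1) continuous_model_map]) (auto intro: model_map_in_model)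
  have "half t * pullback proj c (\<gamma> t) = pullback proj (\<lambda>q. c (model_map \<alpha> q)) t" for t
    using zero_le_lift[of t] by (auto simp: pullback_def indicator_def proj_lift)
  then have "U o\<^sub>L T o\<^sub>L adj U = model_op proj (\<lambda>q. c (model_map \<alpha> q))"
    using U_conjugate(1)[OF bounded_borel_pullback[OF c(1)]] by (simp add: c model_op_def)
  then show "(\<lambda>T\<in>model_algebra. point_character q (U o\<^sub>L T o\<^sub>L adj U)) T =
      point_character (model_map \<alpha> q) T"
    using \<open>T \<in> model_algebra\<close> q c c' by (simp add: point_character_eq model_map_in_model)
qed simp

end

theorem theorem4p4:
  fixes \<alpha> :: "complex \<Rightarrow> complex" and \<gamma> :: "real \<Rightarrow> real"
    and UU U :: "L2 \<Rightarrow>\<^sub>L L2"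
  assumes "\<exists>\<beta>. homeomorphism (sphere 0 1) (sphere 0 1) \<alpha> \<beta>"
    and "orientation_preserving \<alpha>"
    and "is_lift \<alpha> \<gamma>"
    and "\<gamma> 0 > 0"
    and "is_unitary UU"
    and "\<And>f. f \<in> sq_integrable \<Longrightarrow>
      AE t in lborel. L2_rep (UU (L2_class f)) t
        = complex_of_real (sqrt \<bar>deriv \<gamma> t\<bar>) * f (\<gamma> t)"
    and "U = compression UU"
  shows "\<exists>(M :: (enat \<times> complex) set) \<Phi>.
    (\<gamma> 0 \<ge> 1 \<longrightarrow> M = UNIV \<times> sphere 0 1) \<and>
    (0 < \<gamma> 0 \<and> \<gamma> 0 < 1 \<longrightarrow>
      M = (\<Union>N. {enat N} \<times> unit_arc \<gamma> N) \<union> {\<infinity>} \<times> sphere 0 1) \<and>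
    homeomorphic_map (top_of_set M) (spectrum (alg_B U)) \<Phi> \<and>
    (\<forall>p\<in>M. model_map \<alpha> p \<in> M \<and>
      \<Phi> (model_map \<alpha> p) = generated_map U (alg_B U) (\<Phi> p))"
proof -
  obtain \<beta> where \<beta>: "homeomorphism (sphere 0 1) (sphere 0 1) \<alpha> \<beta>" using assms(1) by blast
  have mono: "strict_mono \<gamma>" by (rule lift_strict_mono[OF assms(2,3)])
  have inj: "inj_on \<alpha> (sphere 0 1)" using \<beta> by (intro inj_on_inverseI[of _ \<beta>]) (simp add: homeomorphism_def)
  interpret W: weighted_composition \<alpha> \<gamma> UU "\<lambda>t. complex_of_real (sqrt \<bar>deriv \<gamma> t\<bar>)"
  proof
    show "continuous_on (sphere 0 1) \<alpha>" using \<beta> by (simp add: homeomorphism_def)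
    show "\<gamma> (t + 1) = \<gamma> t + 1" for t by (rule lift_shift[OF inj assms(3) mono])
  qed (use assms mono in auto)
  have U: "U = W.U" using assms(7) by (simp add: W.U_def)
  have full: "W.model = UNIV \<times> sphere 0 1" if "1 \<le> \<gamma> 0"
    by (auto simp: W.model_def W.unit_arc_full[OF that])
  \<comment> \<open>At finite levels the circle condition in \<open>model\<close> is implied by
    membership in the arc; at level \<infinity> it is the only condition.\<close>
  have arcs: "W.model = (\<Union>N. {enat N} \<times> unit_arc \<gamma> N) \<union> {\<infinity>} \<times> sphere 0 1"
  proof (intro set_eqI)
    fix q :: "enat \<times> complex"
    show "q \<in> W.model \<longleftrightarrow> q \<in> (\<Union>N. {enat N} \<times> unit_arc \<gamma> N) \<union> {\<infinity>} \<times> sphere 0 1"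
      by (cases q, cases "fst q") (auto simp: W.model_def unit_arc_def)
  qed
  show ?thesis
    unfolding U
  proof (intro exI[of _ W.model] exI[of _ W.point_character] conjI impI ballI)
    fix q assume "q \<in> W.model"
    then show "model_map \<alpha> q \<in> W.model"
      and "W.point_character (model_map \<alpha> q) = generated_map W.U (alg_B W.U) (W.point_character q)"
      by (simp_all add: W.model_map_in_model W.generated_map_point_character)
  qed (use full arcs W.spectrum_alg_B in simp_all)
qed

end
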